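(* Let $p$ be a prime number and let $L$ be a monic differential operator with coefficients in $\mathbb{Q}(z)$, of order $n\geq 2$ and of MUM type. Suppose that $L\in\mathbb{Z}_p[[z]][\delta]$ and that $L$ has a $p$-integral Frobenius structure $\Phi=(\phi_{i,j}(z))_{1\leq i,j\leq n}$ with $|\phi_{1,1}(0)|=1$. Then $\exp(y_1/y_0)\in z\mathbb{Z}_p[[z]]$ if and only if there exists $\mathcal{B}=B_1(z)+B_2(z)\delta\in\mathbb{Z}_p[[z]][\delta]$ with $B_1(0)=1$ and $B_2(0)=0$ such that, for every solution $y$ of $L^{(2)}$, $\mathcal{B}(y(z^p))$ is a solution of $L^{(2)}$.
   Context: Here $\delta=z\frac{d}{dz}$ and $|\cdot|$ is the $p$-adic norm. A monic operator $L=\delta^n+a_{n-1}(z)\delta^{n-1}+\cdots+a_0(z)$ with coefficients in $\mathbb{Q}(z)$ is of MUM type if $a_i(z)\in\mathbb{Q}(z)\cap z\mathbb{Q}[[z]]$ for all $i$. For such $L$ with $n\ge 2$ there are unique $\mathfrak{f}(z)\in 1+z\mathbb{Q}[[z]]$ and $\mathfrak{g}(z)\in z\mathbb{Q}[[z]]$ such that $y_0=\mathfrak{f}(z)$ and $y_1=\mathfrak{f}(z)\log z+\mathfrak{g}(z)$ are solutions of $L$ (with $\log z$ a formal symbol, transcendental over power series, $\delta\log z=1$). By definition $\exp(y_1/y_0):=z\exp(\mathfrak{g}/\mathfrak{f})$. The companion matrix $A(z)$ of $L$ is the $n\times n$ matrix with $1$'s on the superdiagonal, last row $(-a_0,-a_1,\ldots,-a_{n-1})$,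 zeros elsewhere. A $p$-integral Frobenius structure for $L$ is a matrix $\Phi\in M_n(\mathbb{Z}_p[[z]])$ with $\det\Phi\neq 0$ and $\delta\Phi=A(z)\Phi-p\,\Phi A(z^p)$. $L^{(2)}\in\mathbb{Q}_p[[z]][\delta]$ is the order-$2$ operator $L^{(2)}=(\delta-t_2)(\delta-t_1)$, where $t_1=\frac{\delta\mathfrak{f}}{\mathfrak{f}}$, $t_2=\frac{\delta\mathfrak{h}}{\mathfrak{h}}$, $\mathfrak{h}=\mathfrak{f}+\delta\mathfrak{g}-t_1\mathfrak{g}$; it has $y_0$ and $y_1$ as solutions. Solutions of $L^{(2)}$ are taken in $\mathbb{Q}_p[[z]]+\mathbb{Q}_p[[z]]\log z$, and for such $y$, $y(z^p)$ is obtained by substituting $z\mapsto z^p$, $\log z\mapsto p\log z$. *)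

theory Defs
  imports
    "HOL-Computational_Algebra.Computational_Algebra"
    "Jordan_Normal_Form.Determinant"
    "Berlekamp_Zassenhaus.Finite_Field"
begin

hide_const (open) up_ring.coeff module.smult

section \<open>The \<open>p\<close>-adic integers and the \<open>p\<close>-adic numbers\<close>

text \<open>
  The prime \<open>p\<close> is the cardinality of the type parameter \<open>'p\<close>.  A \<open>p\<close>-adic integer is a
  coherent sequence of residues modulo \<open>p ^ k\<close>, each given by its representative in
  \<open>{0..<p ^ k}\<close>; that is, \<open>\<int>\<^sub>p\<close> is the inverse limit of the rings \<open>\<int>/p ^ k\<close>.
\<close>

typedef (overloaded) ('p::prime_card) padic_int =
  "{f :: nat \<Rightarrow> int. \<forall>k. f k \<in> {0..<int CARD('p) ^ k} \<and> f (Suc k) mod int CARD('p) ^ k = f k}"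
  by (rule exI[of _ "\<lambda>_. 0"]) (simp add: zero_less_card_finite)

setup_lifting type_definition_padic_int

lemma prime_card_pow_pos: "(0::int) < int CARD('p::prime_card) ^ k"
  by (simp add: zero_less_card_finite)

lemma padic_mod_coherent:
  fixes x :: int
  shows "x mod int q ^ Suc k mod int q ^ k = x mod int q ^ k"
  by (rule mod_mod_cancel) (simp add: le_imp_power_dvd)

instantiation padic_int :: (prime_card) comm_ring_1
begin

lift_definition zero_padic_int :: "'a padic_int" is "\<lambda>_. 0"
  by (simp add: zero_less_card_finite)

lift_definition one_padic_int :: "'a padic_int" is "\<lambda>k. 1 mod int CARD('a) ^ k"
  using padic_mod_coherent[of 1 "CARD('a)"]
  by (auto simp add: prime_card_pow_pos simp del: power_Suc)

lift_definition plus_padic_int :: "'a padic_int \<Rightarrow> 'a padic_int \<Rightarrow> 'a padic_int"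
  is "\<lambda>f g k. (f k + g k) mod int CARD('a) ^ k"
proof -
  fix f g :: "nat \<Rightarrow> int" and k :: nat
  assume f: "\<And>k. f k \<in> {0..<int CARD('a) ^ k} \<and> f (Suc k) mod int CARD('a) ^ k = f k"
    and g: "\<And>k. g k \<in> {0..<int CARD('a) ^ k} \<and> g (Suc k) mod int CARD('a) ^ k = g k"
  have "(f (Suc k) + g (Suc k)) mod int CARD('a) ^ k = (f k + g k) mod int CARD('a) ^ k"
    using f g by (metis mod_add_eq)
  then show "(f k + g k) mod int CARD('a) ^ k \<in> {0..<int CARD('a) ^ k} \<and>
      (f (Suc k) + g (Suc k)) mod int CARD('a) ^ Suc k mod int CARD('a) ^ k
        = (f k + g k) mod int CARD('a) ^ k"
    by (simp only: padic_mod_coherent) (simp add: prime_card_pow_pos)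
qed

lift_definition times_padic_int :: "'a padic_int \<Rightarrow> 'a padic_int \<Rightarrow> 'a padic_int"
  is "\<lambda>f g k. (f k * g k) mod int CARD('a) ^ k"
proof -
  fix f g :: "nat \<Rightarrow> int" and k :: nat
  assume f: "\<And>k. f k \<in> {0..<int CARD('a) ^ k} \<and> f (Suc k) mod int CARD('a) ^ k = f k"
    and g: "\<And>k. g k \<in> {0..<int CARD('a) ^ k} \<and> g (Suc k) mod int CARD('a) ^ k = g k"
  have "(f (Suc k) * g (Suc k)) mod int CARD('a) ^ k = (f k * g k) mod int CARD('a) ^ k"
    using f g by (metis mod_mult_eq)
  then show "(f k * g k) mod int CARD('a) ^ k \<in> {0..<int CARD('a) ^ k} \<and>
      (f (Suc k) * g (Suc k)) mod int CARD('a) ^ Suc k mod int CARD('a) ^ k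
        = (f k * g k) mod int CARD('a) ^ k"
    by (simp only: padic_mod_coherent) (simp add: prime_card_pow_pos)
qed

lift_definition uminus_padic_int :: "'a padic_int \<Rightarrow> 'a padic_int"
  is "\<lambda>f k. (- f k) mod int CARD('a) ^ k"
proof -
  fix f :: "nat \<Rightarrow> int" and k :: nat
  assume f: "\<And>k. f k \<in> {0..<int CARD('a) ^ k} \<and> f (Suc k) mod int CARD('a) ^ k = f k"
  have "(- f (Suc k)) mod int CARD('a) ^ k = (- f k) mod int CARD('a) ^ k"
    using f by (metis mod_minus_eq)
  then show "(- f k) mod int CARD('a) ^ k \<in> {0..<int CARD('a) ^ k} \<and>
      (- f (Suc k)) mod int CARD('a) ^ Suc k mod int CARD('a) ^ k = (- f k) mod int CARD('a) ^ k"
    by (simp only: padic_mod_coherent) (simp add: prime_card_pow_pos)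
qed

definition minus_padic_int :: "'a padic_int \<Rightarrow> 'a padic_int \<Rightarrow> 'a padic_int"
  where "minus_padic_int a b = a + - b"

instance
proof
  fix a b c :: "'a padic_int"
  show "a * b * c = a * (b * c)"
    by transfer (simp add: mod_simps mult.assoc)
  show "a * b = b * a"
    by transfer (simp add: mult.commute)
  show "1 * a = a"
    by transfer (auto simp add: mod_simps)
  show "a + b + c = a + (b + c)"
    by transfer (simp add: mod_simps add.assoc)
  show "a + b = b + a"
    by transfer (simp add: add.commute)
  show "0 + a = a"
    by transfer auto
  show "- a + a = 0"
    by transfer (simp add: mod_simps)
  show "a - b = a + - b"
    by (simp add: minus_padic_int_def)
  show "(a + b) * c = a * c + b * c"
    by transfer (simp add: mod_simps distrib_right)
  show "(0::'a padic_int) \<noteq> 1"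
  proof
    assume "(0::'a padic_int) = 1"
    then have "Rep_padic_int (0::'a padic_int) 1 = Rep_padic_int 1 1"
      by simp
    moreover have "1 mod int CARD('a) = 1"
      using prime_gt_1_nat[OF prime_card[where 'a='a]] by simp
    ultimately show False
      by (simp add: zero_padic_int.rep_eq one_padic_int.rep_eq)
  qed
qed

end

lemma padic_int_trunc:
  fixes f :: "nat \<Rightarrow> int"
  assumes "\<forall>k. f k \<in> {0..<int q ^ k} \<and> f (Suc k) mod int q ^ k = f k"
  shows "f (k + m) mod int q ^ k = f k"
proof (induction m)
  case 0
  then show ?case using assms by simp
next
  case (Suc m)
  have "f (k + Suc m) mod int q ^ k = f (Suc (k + m)) mod int q ^ (k + m) mod int q ^ k"
    by (simp add: mod_mod_cancel le_imp_power_dvd)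
  also have "\<dots> = f k"
    using assms Suc by simp
  finally show ?case .
qed

instance padic_int :: (prime_card) idom
proof
  fix a b :: "'a padic_int"
  assume "a \<noteq> 0" "b \<noteq> 0"
  then show "a * b \<noteq> 0"
  proof transfer
    fix f g :: "nat \<Rightarrow> int"
    let ?p = "int CARD('a)"
    assume f: "\<forall>k. f k \<in> {0..<?p ^ k} \<and> f (Suc k) mod ?p ^ k = f k"
      and g: "\<forall>k. g k \<in> {0..<?p ^ k} \<and> g (Suc k) mod ?p ^ k = g k"
      and nz: "f \<noteq> (\<lambda>_. 0)" "g \<noteq> (\<lambda>_. 0)"
    from nz obtain m l where m: "f m \<noteq> 0" and l: "g l \<noteq> 0" by (meson ext)
    have nf: "\<not> ?p ^ m dvd f (m + l)"
      using padic_int_trunc[OF f, of m l] m unfolding dvd_eq_mod_eq_0 by argo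
    have ng: "\<not> ?p ^ l dvd g (m + l)"
      using padic_int_trunc[OF g, of l m] l unfolding dvd_eq_mod_eq_0 add.commute[of m l] by argo
    have pr: "prime_elem ?p"
      by (rule prime_imp_prime_elem[OF prime_card_int])
    have "\<not> ?p ^ (m + l) dvd f (m + l) * g (m + l)"
    proof
      assume "?p ^ (m + l) dvd f (m + l) * g (m + l)"
      then obtain x y where xy: "x + y = m + l" "?p ^ x dvd f (m + l)" "?p ^ y dvd g (m + l)"
        using prime_elem_power_dvd_prod[OF _ pr] by blast
      have "m \<le> x \<or> l \<le> y" using xy(1) by linarith
      then show False
        using xy(2,3) nf ng power_le_dvd by blast
    qed
    then show "(\<lambda>k. f k * g k mod ?p ^ k) \<noteq> (\<lambda>_. 0)"
      unfolding fun_eq_iff dvd_eq_mod_eq_0 by blast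
  qed
qed

lemma Rep_padic_int_of_nat:
  "Rep_padic_int (of_nat n :: 'p::prime_card padic_int) k = int n mod int CARD('p) ^ k"
  by (induction n)
    (simp_all add: zero_padic_int.rep_eq plus_padic_int.rep_eq one_padic_int.rep_eq mod_simps)

instance padic_int :: (prime_card) ring_char_0
proof
  show "inj (of_nat :: nat \<Rightarrow> 'a padic_int)"
  proof (rule injI)
    fix m n :: nat
    assume eq: "(of_nat m :: 'a padic_int) = of_nat n"
    let ?k = "m + n"
    have "1 < CARD('a)" using prime_gt_1_nat[OF prime_card] .
    then have "?k < CARD('a) ^ ?k" by (simp add: power_gt_expt)
    then have "int m < int CARD('a) ^ ?k" "int n < int CARD('a) ^ ?k"
      by (simp_all flip: of_nat_power)
    then show "m = n"
      using arg_cong[OF eq, of "\<lambda>x. Rep_padic_int x ?k"] by (simp add: Rep_padic_int_of_nat)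
  qed
qed

lemma of_nat_fract: "(of_nat n :: 'a::idom fract) = to_fract (of_nat n)"
  by (induction n) simp_all

instance fract :: ("{idom,ring_char_0}") field_char_0
  by standard (simp add: inj_def of_nat_fract)

type_synonym 'p padic = "'p padic_int fract"

definition padic_integers :: "'p::prime_card padic set"  (\<open>\<int>\<^sub>p\<close>)
  where "\<int>\<^sub>p = range to_fract"

definition padic_val :: "'p::prime_card padic \<Rightarrow> int"
  where "padic_val x = (GREATEST k. x * of_nat CARD('p) powi (- k) \<in> \<int>\<^sub>p)"

definition padic_norm :: "'p::prime_card padic \<Rightarrow> real"
  where "padic_norm x = (if x = 0 then 0 else real CARD('p) powi (- padic_val x))"


section \<open>Power series\<close>

definition padic_integral_fps :: "'p::prime_card padic fps set"  (\<open>\<int>\<^sub>p[[z]]\<close>)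
  where "\<int>\<^sub>p[[z]] = {F. \<forall>k. fps_nth F k \<in> \<int>\<^sub>p}"

definition fps_of_rat :: "rat fps \<Rightarrow> 'a::field_char_0 fps"
  where "fps_of_rat F = Abs_fps (\<lambda>k. of_rat (fps_nth F k))"

text \<open>The power series that are expansions at \<open>0\<close> of rational functions, i.e.
  \<open>\<rat>(z) \<inter> \<rat>[[z]]\<close>.\<close>

definition rational_fps :: "rat fps set"
  where "rational_fps = {F. \<exists>P Q. Q \<noteq> 0 \<and> F * fps_of_poly Q = fps_of_poly P}"

definition fps_delta :: "'a::comm_ring_1 fps \<Rightarrow> 'a fps"
  where "fps_delta F = fps_X * fps_deriv F"

definition fps_subst_power :: "nat \<Rightarrow> 'a::comm_ring_1 fps \<Rightarrow> 'a fps"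
  where "fps_subst_power p F = F oo fps_X ^ p"


section \<open>Power series with logarithms\<close>

text \<open>
  \<open>K[[z]][log z]\<close>, with \<open>log z\<close> transcendental over \<open>K[[z]]\<close>, is represented as the polynomial
  ring over \<open>K[[z]]\<close>: the series \<open>u + v log z\<close> is \<open>[:u, v:]\<close>.  The derivation \<open>\<delta>\<close> is
  extended by \<open>\<delta> (log z) = 1\<close>, and \<open>z \<mapsto> z ^ p\<close> by \<open>log z \<mapsto> p log z\<close>.
\<close>

type_synonym 'a log_fps = "'a fps poly"

definition log_delta :: "'a::field log_fps \<Rightarrow> 'a log_fps"
  where "log_delta y = map_poly fps_delta y + pderiv y"

definition log_subst_power :: "nat \<Rightarrow> 'a::field log_fps \<Rightarrow> 'a log_fps"
  where "log_subst_power p y = pcompose (map_poly (fps_subst_power p) y) [:0, of_nat p:]"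


section \<open>Differential operators\<close>

text \<open>
  An operator \<open>\<Sum>i\<le>n. a\<^sub>i \<delta>\<^sup>i\<close> in \<open>K[[z]][\<delta>]\<close> is represented by the polynomial with coefficients
  \<open>a\<^sub>i\<close>.  The product of operators is not the product of polynomials, since
  \<open>\<delta> a = a \<delta> + \<delta>(a)\<close>.
\<close>

type_synonym 'a diffop = "'a fps poly"

definition diffop_apply :: "'a::field diffop \<Rightarrow> 'a log_fps \<Rightarrow> 'a log_fps"
  where "diffop_apply P y = (\<Sum>i\<le>degree P. smult (coeff P i) ((log_delta ^^ i) y))"

definition delta_times :: "'a::field diffop \<Rightarrow> 'a diffop"
  where "delta_times Q = pCons 0 Q + map_poly fps_delta Q"

definition diffop_mult :: "'a::field diffop \<Rightarrow> 'a diffop \<Rightarrow> 'a diffop"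
  where "diffop_mult P Q = (\<Sum>i\<le>degree P. smult (coeff P i) ((delta_times ^^ i) Q))"

definition diffop_of_rat :: "rat diffop \<Rightarrow> 'a::field_char_0 diffop"
  where "diffop_of_rat L = map_poly fps_of_rat L"

definition padic_integral_diffop :: "'p::prime_card padic diffop set"  (\<open>\<int>\<^sub>p[[z]][\<delta>]\<close>)
  where "\<int>\<^sub>p[[z]][\<delta>] = {P. \<forall>i. coeff P i \<in> \<int>\<^sub>p[[z]]}"

text \<open>Monic operators of order \<open>n\<close> with coefficients in \<open>\<rat>(z)\<close>, of MUM type.  Their
  non-leading coefficients lie in \<open>\<rat>(z) \<inter> z\<rat>[[z]]\<close>, and are identified with their expansions.\<close>

definition MUM_diffop :: "nat \<Rightarrow> rat diffop \<Rightarrow> bool"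
  where "MUM_diffop n L \<longleftrightarrow> degree L = n \<and> coeff L n = 1 \<and>
    (\<forall>i<n. coeff L i \<in> rational_fps \<and> fps_nth (coeff L i) 0 = 0)"

text \<open>The solutions \<open>y\<^sub>0 = f\<close> and \<open>y\<^sub>1 = f log z + g\<close>.  For an operator of MUM type and order at
  least \<open>2\<close> exactly one pair \<open>(f, g)\<close> has this property.\<close>

definition frobenius_solutions :: "rat diffop \<Rightarrow> rat fps \<Rightarrow> rat fps \<Rightarrow> bool"
  where "frobenius_solutions L f g \<longleftrightarrow> fps_nth f 0 = 1 \<and> fps_nth g 0 = 0 \<and>
    diffop_apply L [:f:] = 0 \<and> diffop_apply L [:g, f:] = 0"

text \<open>\<open>exp (y\<^sub>1 / y\<^sub>0) = z exp (g / f)\<close>\<close>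

definition canonical_coordinate :: "rat fps \<Rightarrow> rat fps \<Rightarrow> rat fps"
  where "canonical_coordinate f g = fps_X * (fps_exp 1 oo (g / f))"


section \<open>Frobenius structures\<close>

definition companion_matrix :: "nat \<Rightarrow> 'a::field diffop \<Rightarrow> 'a fps mat"
  where "companion_matrix n L =
    mat n n (\<lambda>(i, j). if i = n - 1 then - coeff L j else if j = i + 1 then 1 else 0)"

definition frobenius_structure :: "nat \<Rightarrow> rat diffop \<Rightarrow> 'p::prime_card padic fps mat \<Rightarrow> bool"
  where "frobenius_structure n L \<Phi> \<longleftrightarrow>
    (let p = CARD('p); A = companion_matrix n (diffop_of_rat L) in
      \<Phi> \<in> carrier_mat n n \<and> elements_mat \<Phi> \<subseteq> \<int>\<^sub>p[[z]] \<and> det \<Phi> \<noteq> 0 \<and>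
      map_mat fps_delta \<Phi> = A * \<Phi> - of_nat p \<cdot>\<^sub>m (\<Phi> * map_mat (fps_subst_power p) A))"


section \<open>The operator of order two\<close>

definition second_order_diffop :: "'a::field fps \<Rightarrow> 'a fps \<Rightarrow> 'a diffop"
  where "second_order_diffop f g =
    (let t1 = fps_delta f / f;
         h = f + fps_delta g - t1 * g;
         t2 = fps_delta h / h
     in diffop_mult [:- t2, 1:] [:- t1, 1:])"

text \<open>Solutions in \<open>K[[z]] + K[[z]] log z\<close>\<close>

definition is_log_solution :: "'a::field diffop \<Rightarrow> 'a log_fps \<Rightarrow> bool"
  where "is_log_solution P y \<longleftrightarrow> degree y \<le> 1 \<and> diffop_apply P y = 0"

end

theory Submission
  imports Defs "HOL-Number_Theory.Modular_Inverse"
begin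

text \<open>
  Put \<open>R = g / f\<close> and \<open>U = 1 + \<delta> R\<close>, and let \<open>S\<close> be the substitution \<open>z \<mapsto> z ^ p\<close>.  Comparing
  \<open>\<B> (y (z ^ p))\<close> with the solutions \<open>y\<^sub>0\<close> and \<open>y\<^sub>1\<close> of \<open>L\<^sup>(\<^sup>2\<^sup>)\<close> turns the condition on \<open>\<B>\<close> into
  \<open>\<B> (S y\<^sub>0) = y\<^sub>0\<close> and \<open>\<B> (S y\<^sub>1) = p y\<^sub>1\<close>, and eliminating \<open>B\<^sub>1\<close> leaves
  \<open>S R - p R = - p B\<^sub>2 (S f / f) S U\<close>.  By Dwork's criterion \<open>exp R\<close> is integral iff the left-hand side
  lies in \<open>p \<int>\<^sub>p[[z]]\<close>, so it remains to know that \<open>f\<close> and \<open>U\<close> are integral.  Both satisfy equations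
  that express them through \<open>S\<close> of themselves and of their derivatives, with integral coefficients;
  for \<open>f\<close> this is either \<open>\<B> (S f) = f\<close> or the first row of the Frobenius structure.
\<close>

section \<open>Divisibility by \<open>p\<close> in the \<open>p\<close>-adic integers\<close>

lemma Rep_padic_int_coherent:
  "Rep_padic_int x k \<in> {0..<int CARD('p) ^ k}"
  "Rep_padic_int x (Suc k) mod int CARD('p) ^ k = Rep_padic_int x k"
  for x :: "'p::prime_card padic_int"
  using Rep_padic_int[of x] by auto

lemma Rep_padic_int_mod [simp]:
  "Rep_padic_int x k mod int CARD('p) ^ k = Rep_padic_int x k"
  for x :: "'p::prime_card padic_int"
  using Rep_padic_int_coherent(1)[of x k] by simp

lemma Rep_padic_int_Suc_mod:
  "Rep_padic_int x (Suc k) mod int CARD('p) = Rep_padic_int x 1"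
  for x :: "'p::prime_card padic_int"
  using padic_int_trunc[of "Rep_padic_int x" "CARD('p)" 1 k] Rep_padic_int[of x] by simp

text \<open>Each level is determined by the next one, so level 0 can be left out. This matches the
  shift by one level that division by p causes.\<close>

lemma padic_int_eqI:
  fixes x y :: "'p::prime_card padic_int"
  assumes "\<And>k. Rep_padic_int x (Suc k) = Rep_padic_int y (Suc k)"
  shows "x = y"
proof -
  have "Rep_padic_int x k = Rep_padic_int y k" for k
    by (metis assms Rep_padic_int_coherent(2))
  then show ?thesis
    by (simp add: Rep_padic_int_inject[symmetric] fun_eq_iff)
qed

text \<open>For the converse, the residue of \<open>x / p\<close> modulo \<open>p ^ k\<close> is
  read off level \<open>k + 1\<close> of \<open>x\<close>: division by p costs one level of
  precision.\<close>

lemma padic_int_dvd_iff: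
  "of_nat CARD('p) dvd x \<longleftrightarrow> Rep_padic_int x 1 = 0"
  for x :: "'p::prime_card padic_int"
proof
  assume "of_nat CARD('p) dvd x"
  then show "Rep_padic_int x 1 = 0"
    by (auto elim!: dvdE simp: times_padic_int.rep_eq Rep_padic_int_of_nat)
next
  let ?p = "int CARD('p)"
  have p0: "?p > 0" by (simp add: zero_less_card_finite)
  assume x: "Rep_padic_int x 1 = 0"
  define f where "f k = Rep_padic_int x (Suc k) div ?p" for k
  have f: "Rep_padic_int x (Suc k) = ?p * f k" for k
    using Rep_padic_int_Suc_mod[of x k] x unfolding f_def by (simp add: mod_eq_0_iff_dvd)
  have "f k \<in> {0..<?p ^ k} \<and> f (Suc k) mod ?p ^ k = f k" for k
  proof
    have "0 \<le> ?p * f k" "?p * f k < ?p * ?p ^ k"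
      using Rep_padic_int_coherent(1)[of x "Suc k"] by (auto simp: f)
    then show "f k \<in> {0..<?p ^ k}"
      using p0 by (auto simp: zero_le_mult_iff)
    have "?p * f (Suc k) mod (?p * ?p ^ k) = ?p * f k"
      using Rep_padic_int_coherent(2)[of x "Suc k"] by (simp add: f)
    then show "f (Suc k) mod ?p ^ k = f k"
      using p0 by (simp add: mult_mod_right[symmetric])
  qed
  then have Rep: "Rep_padic_int (Abs_padic_int f :: 'p padic_int) = f"
    by (intro Abs_padic_int_inverse) simp
  have "x = of_nat CARD('p) * Abs_padic_int f"
  proof (rule padic_int_eqI)
    fix k
    have "f (Suc k) mod ?p ^ k = f k"
      using \<open>f k \<in> {0..<?p ^ k} \<and> f (Suc k) mod ?p ^ k = f k\<close> by blast
    then have "?p * f (Suc k) mod (?p * ?p ^ k) = ?p * f k"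
      by (simp add: mult_mod_right[symmetric])
    then show "Rep_padic_int x (Suc k) =
        Rep_padic_int (of_nat CARD('p) * Abs_padic_int f :: 'p padic_int) (Suc k)"
      by (simp add: times_padic_int.rep_eq Rep_padic_int_of_nat Rep f mod_simps)
  qed
  then show "of_nat CARD('p) dvd x" by simp
qed

text \<open>Inverses modulo \<open>p ^ k\<close> exist at every level and, being unique in their
  range, fit together to a p-adic integer.\<close>

lemma padic_int_unit:
  fixes x :: "'p::prime_card padic_int"
  assumes "\<not> of_nat CARD('p) dvd x"
  shows "x dvd 1"
proof -
  let ?p = "int CARD('p)"
  define f where "f = Rep_padic_int x"
  define g where "g k = modular_inverse (?p ^ k) (f k)" for k
  have p1: "?p > 1" using prime_gt_1_nat[OF prime_card[where 'a = 'p]] by simp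
  have cop: "coprime (f k) (?p ^ k)" for k
  proof (cases k)
    case (Suc l)
    have "\<not> ?p dvd f k"
      using assms Rep_padic_int_Suc_mod[of x l]
      by (simp add: padic_int_dvd_iff f_def Suc mod_eq_0_iff_dvd[symmetric])
    then show ?thesis
      using prime_imp_coprime[OF prime_card_int[where 'a = 'p]] coprime_commute coprime_power_right_iff
      by blast
  qed simp
  have "g k \<in> {0..<?p ^ k} \<and> g (Suc k) mod ?p ^ k = g k" for k
  proof
    show "g k \<in> {0..<?p ^ k}"
      using p1 by (simp add: g_def modular_inverse_int_nonneg modular_inverse_int_less)
    have "[f (Suc k) * g (Suc k) = 1] (mod ?p ^ k)"
      unfolding g_def using cong_modular_inverse1[OF cop[of "Suc k"]]
      by (rule cong_dvd_modulus) (simp add: le_imp_power_dvd)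
    moreover have "[f (Suc k) = f k] (mod ?p ^ k)"
      by (simp add: f_def cong_def Rep_padic_int_coherent)
    ultimately have "[f k * (g (Suc k) mod ?p ^ k) = 1] (mod ?p ^ k)"
      using cong_mult[of "f (Suc k)" "f k" "?p ^ k" "g (Suc k)" "g (Suc k) mod ?p ^ k"]
        cong_trans cong_sym by (fastforce simp: cong_def)
    then show "g (Suc k) mod ?p ^ k = g k"
      using modular_inverse_int_eqI[of "g (Suc k) mod ?p ^ k" "?p ^ k" "f k"] p1
      by (simp add: g_def)
  qed
  then have Rep: "Rep_padic_int (Abs_padic_int g :: 'p padic_int) = g"
    by (intro Abs_padic_int_inverse) simp
  have "x * Abs_padic_int g = 1"
    using cong_modular_inverse1[OF cop]
    by (intro padic_int_eqI) (simp add: times_padic_int.rep_eq one_padic_int.rep_eq Rep f_def[symmetric] g_def cong_def)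
  then show ?thesis by (metis dvdI)
qed

lemma padic_int_of_nat_dvd_iff:
  "of_nat CARD('p) dvd (of_nat m :: 'p::prime_card padic_int) \<longleftrightarrow> CARD('p) dvd m"
  by (simp add: padic_int_dvd_iff Rep_padic_int_of_nat mod_eq_0_iff_dvd)

text \<open>Divisibility by p sees only the residue modulo p, where this is Fermat's little theorem
  for the natural number representing \<open>x\<close>.\<close>

lemma padic_int_fermat: "of_nat CARD('p) dvd x ^ CARD('p) - x"
  for x :: "'p::prime_card padic_int"
proof -
  let ?p = "int CARD('p)"
  have Rep_power: "Rep_padic_int (x ^ n) 1 = Rep_padic_int x 1 ^ n mod ?p" for n
    by (induction n) (simp_all add: one_padic_int.rep_eq times_padic_int.rep_eq mod_simps)
  have Rep_diff: "Rep_padic_int (a - b) 1 = (Rep_padic_int a 1 - Rep_padic_int b 1) mod ?p"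
    for a b :: "'p padic_int"
    by (simp only: minus_padic_int_def plus_padic_int.rep_eq uminus_padic_int.rep_eq power_one_right
        mod_add_right_eq diff_conv_add_uminus[of _ "Rep_padic_int b 1"])
  define m where "m = nat (Rep_padic_int x 1)"
  have m: "Rep_padic_int x 1 = int m"
    using Rep_padic_int_coherent(1)[of x 1] by (simp add: m_def)
  have "[m ^ CARD('p) = m] (mod CARD('p))"
  proof (cases "CARD('p) dvd m")
    case True
    then have "CARD('p) dvd m ^ CARD('p)"
      by (rule dvd_trans[OF _ dvd_power]) (simp add: zero_less_card_finite)
    with True show ?thesis
      by (simp only: cong_def dvd_imp_mod_0)
  next
    case False
    then have "[m * m ^ (CARD('p) - 1) = m * 1] (mod CARD('p))"
      by (intro cong_mult fermat_theorem prime_card cong_refl)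
    then show ?thesis
      by (simp add: power_eq_if zero_less_card_finite)
  qed
  then have "int m ^ CARD('p) mod ?p = int m mod ?p"
    by (metis cong_def of_nat_mod of_nat_power)
  then have "?p dvd int m ^ CARD('p) - int m"
    by (simp only: mod_eq_dvd_iff)
  then show ?thesis
    unfolding padic_int_dvd_iff Rep_diff Rep_power m mod_diff_left_eq by (rule dvd_imp_mod_0)
qed

text \<open>The witness is a level at which the residue of \<open>x\<close> is nonzero. It will
  bound the exponents in the \<open>GREATEST\<close> that defines \<open>padic_val\<close>.\<close>

lemma padic_int_power_not_dvd:
  fixes x :: "'p::prime_card padic_int"
  assumes "x \<noteq> 0"
  obtains m where "\<not> of_nat CARD('p) ^ m dvd x"
proof -
  from assms obtain m where "Rep_padic_int x m \<noteq> 0"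
    by (metis padic_int_eqI zero_padic_int.rep_eq)
  moreover have "Rep_padic_int (of_nat (CARD('p) ^ m) * c) m = 0" for c :: "'p padic_int"
    by (simp only: times_padic_int.rep_eq Rep_padic_int_of_nat) (simp add: mod_simps)
  ultimately have "\<not> of_nat CARD('p) ^ m dvd x"
    by (auto elim!: dvdE)
  then show ?thesis by (rule that)
qed

section \<open>The subring \<open>\<int>\<^sub>p\<close> of \<open>\<rat>\<^sub>p\<close>\<close>

lemma padic_integers_0 [simp, intro]: "0 \<in> \<int>\<^sub>p"
  and padic_integers_1 [simp, intro]: "1 \<in> \<int>\<^sub>p"
  unfolding padic_integers_def by (metis rangeI to_fract_0, metis rangeI to_fract_1)

lemma padic_integers_add [intro]: "x \<in> \<int>\<^sub>p \<Longrightarrow> y \<in> \<int>\<^sub>p \<Longrightarrow> x + y \<in> \<int>\<^sub>p"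
  and padic_integers_mult [intro]: "x \<in> \<int>\<^sub>p \<Longrightarrow> y \<in> \<int>\<^sub>p \<Longrightarrow> x * y \<in> \<int>\<^sub>p"
  and padic_integers_diff [intro]: "x \<in> \<int>\<^sub>p \<Longrightarrow> y \<in> \<int>\<^sub>p \<Longrightarrow> x - y \<in> \<int>\<^sub>p"
  and padic_integers_uminus [intro]: "x \<in> \<int>\<^sub>p \<Longrightarrow> - x \<in> \<int>\<^sub>p"
  unfolding padic_integers_def
  by (auto simp flip: to_fract_add to_fract_mult to_fract_diff to_fract_uminus)

lemma padic_integers_of_nat [simp, intro]: "of_nat n \<in> \<int>\<^sub>p"
  by (simp add: padic_integers_def of_nat_fract)

lemma padic_integers_power [intro]: "x \<in> \<int>\<^sub>p \<Longrightarrow> x ^ n \<in> \<int>\<^sub>p"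
  by (induction n) auto

lemma padic_integers_sum [intro]: "(\<And>i. i \<in> A \<Longrightarrow> f i \<in> \<int>\<^sub>p) \<Longrightarrow> sum f A \<in> \<int>\<^sub>p"
  by (induction A rule: infinite_finite_induct) auto

lemma to_fract_divide_card_iff:
  "to_fract x / of_nat CARD('p) \<in> \<int>\<^sub>p \<longleftrightarrow> of_nat CARD('p) dvd x"
  for x :: "'p::prime_card padic_int"
proof
  assume "to_fract x / of_nat CARD('p) \<in> \<int>\<^sub>p"
  then obtain y where "to_fract x / of_nat CARD('p) = to_fract y"
    by (auto simp: padic_integers_def)
  then have "to_fract x = to_fract (of_nat CARD('p) * y)"
    by (simp add: field_simps of_nat_fract zero_less_card_finite)
  then have "x = of_nat CARD('p) * y"
    by (simp only: to_fract_eq_iff)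
  then show "of_nat CARD('p) dvd x" by simp
next
  assume "of_nat CARD('p) dvd x"
  then obtain y where "x = of_nat CARD('p) * y" ..
  then have "to_fract x / of_nat CARD('p) = to_fract y"
    by (simp add: of_nat_fract)
  then show "to_fract x / of_nat CARD('p) \<in> \<int>\<^sub>p"
    by (simp add: padic_integers_def)
qed

text \<open>The second assumption says that p does not divide the preimage of \<open>x\<close> in
  the ring, which is then a unit by \<open>padic_int_unit\<close>.\<close>

lemma padic_integers_inverse:
  fixes x :: "'p::prime_card padic"
  assumes "x \<in> \<int>\<^sub>p" "x / of_nat CARD('p) \<notin> \<int>\<^sub>p"
  shows "inverse x \<in> \<int>\<^sub>p"
proof -
  obtain y where y: "x = to_fract y" using assms(1) by (auto simp: padic_integers_def)
  with assms(2) obtain w where "1 = y * w"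
    using padic_int_unit[of y] by (auto simp: to_fract_divide_card_iff)
  then have "to_fract y * to_fract w = 1"
    by (simp only: to_fract_mult[symmetric] to_fract_1)
  then have "inverse x = to_fract w"
    unfolding y by (rule inverse_unique)
  then show ?thesis by (simp add: padic_integers_def)
qed

lemma padic_integers_inverse_of_nat:
  assumes "\<not> CARD('p) dvd m"
  shows "inverse (of_nat m) \<in> (\<int>\<^sub>p :: 'p::prime_card padic set)"
  by (rule padic_integers_inverse[OF padic_integers_of_nat])
    (simp only: of_nat_fract[of m] to_fract_divide_card_iff padic_int_of_nat_dvd_iff assms not_False_eq_True)

lemma padic_integers_fermat:
  fixes x :: "'p::prime_card padic"
  assumes "x \<in> \<int>\<^sub>p"
  shows "(x ^ CARD('p) - x) / of_nat CARD('p) \<in> \<int>\<^sub>p"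
proof -
  obtain y where y: "x = to_fract y" using assms by (auto simp: padic_integers_def)
  have "x ^ k = to_fract (y ^ k)" for k
    by (induction k) (simp_all add: y)
  then have "x ^ CARD('p) - x = to_fract (y ^ CARD('p) - y)"
    by (simp add: y)
  then show ?thesis
    by (simp only: to_fract_divide_card_iff padic_int_fermat)
qed

text \<open>Norm 1 means valuation 0. If \<open>x / p\<close> were integral, the exponent 1 would be
  admissible and the valuation would be at least 1.\<close>

lemma padic_norm_eq_1_imp_inverse:
  fixes x :: "'p::prime_card padic"
  assumes "x \<in> \<int>\<^sub>p" "padic_norm x = 1"
  shows "inverse x \<in> \<int>\<^sub>p"
proof (rule padic_integers_inverse[OF assms(1)])
  let ?q = "of_nat CARD('p) :: 'p padic"
  define P where "P k \<longleftrightarrow> x * ?q powi (- k) \<in> \<int>\<^sub>p" for k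
  have q0: "?q \<noteq> 0" by (simp add: zero_less_card_finite)
  have card1: "real CARD('p) > 1" using prime_gt_1_nat[OF prime_card[where 'a = 'p]] by simp
  have x0: "x \<noteq> 0" using assms(2) by (auto simp: padic_norm_def)
  obtain y where y: "x = to_fract y" using assms(1) by (auto simp: padic_integers_def)
  obtain m where m: "\<not> of_nat CARD('p) ^ m dvd y"
    using padic_int_power_not_dvd[of y] x0 y by auto
  have q_power: "?q ^ k = to_fract (of_nat (CARD('p) ^ k))" for k
    by (metis of_nat_power of_nat_fract)
  have P_power: "of_nat CARD('p) ^ k dvd y" if "P (int k)" for k
  proof -
    have "x / ?q ^ k \<in> \<int>\<^sub>p"
      using that by (simp add: P_def power_int_minus divide_inverse)
    then obtain w where "x / ?q ^ k = to_fract w" by (auto simp: padic_integers_def)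
    then have "to_fract y = to_fract (of_nat (CARD('p) ^ k) * w)"
      using q0 q_power[of k] by (simp add: field_simps y)
    then have "y = of_nat (CARD('p) ^ k) * w" by (simp only: to_fract_eq_iff)
    then show ?thesis by simp
  qed
  \<comment> \<open>\<open>GREATEST\<close> denotes an actual maximum only once the admissible
    exponents are bounded above.\<close>
  have bound: "k < int m" if "P k" for k
  proof (rule ccontr)
    assume "\<not> k < int m"
    then have "P (int (nat k))" "m \<le> nat k" using that by auto
    then show False using P_power m power_le_dvd by blast
  qed
  have "P 0" using assms(1) by (simp add: P_def)
  have "padic_val x = 0"
    using assms(2) x0 card1
      power_int_strict_increasing[of 0 "- padic_val x" "real CARD('p)"]
      power_int_strict_increasing[of "- padic_val x" 0 "real CARD('p)"]
    by (cases "padic_val x" "0 :: int" rule: linorder_cases) (auto simp: padic_norm_def)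
  show "x / of_nat CARD('p) \<notin> \<int>\<^sub>p"
  proof
    assume "x / of_nat CARD('p) \<in> \<int>\<^sub>p"
    then have "P 1" by (simp add: P_def power_int_minus divide_inverse)
    \<comment> \<open>The admissible exponents are unbounded below, so the maximum is taken over the
      nonnegative ones, a finite set.\<close>
    define A where "A = {k. P k \<and> k \<ge> 0}"
    have A: "finite A" "0 \<in> A" "1 \<in> A"
      using bound \<open>P 0\<close> \<open>P 1\<close> finite_subset[of A "{0..int m}"] by (fastforce simp: A_def)+
    have "(GREATEST k. P k) = Max A"
    proof (rule Greatest_equality)
      show "P (Max A)" using Max_in[of A] A by (auto simp: A_def)
      show "k \<le> Max A" if "P k" for k
        using Max_ge[OF A(1), of k] Max_ge[OF A(1,2)] that by (fastforce simp: A_def)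
    qed
    then show False
      using \<open>padic_val x = 0\<close> Max_ge[OF A(1,3)] by (simp add: padic_val_def P_def)
  qed
qed

section \<open>The p-adic valuation of factorials\<close>

text \<open>Legendre's formula in recursive form: \<open>k div p\<close> of the factors of
  \<open>k!\<close> are multiples of p, and removing one p from each leaves
  \<open>fact (k div p)\<close>. In the induction both sides change only when p divides
  \<open>Suc k\<close>.\<close>

lemma multiplicity_fact_div:
  assumes "prime (p::nat)"
  shows "multiplicity p (fact k :: nat) = k div p + multiplicity p (fact (k div p) :: nat)"
proof (induction k)
  case 0
  then show ?case by simp
next
  case (Suc k)
  note p = prime_imp_prime_elem[OF assms] prime_gt_1_nat[OF assms]
  have Suc_fact: "multiplicity p (fact (Suc j) :: nat) = multiplicity p (Suc j) + multiplicity p (fact j :: nat)" for j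
    using p by (simp only: fact_Suc of_nat_id) (rule prime_elem_multiplicity_mult_distrib, auto)
  show ?case
  proof (cases "p dvd Suc k")
    case True
    then obtain q where q: "Suc k = p * q" ..
    then obtain r where r: "q = Suc r" by (cases q) auto
    have "Suc k div p = Suc r" using p q r by simp
    moreover have "k div p = r"
      using p q r by (intro div_nat_eqI) auto
    moreover have "multiplicity p (Suc k) = Suc (multiplicity p (Suc r))"
      using p unfolding q r by (intro multiplicity_times_same) auto
    ultimately show ?thesis
      by (simp add: Suc_fact Suc.IH del: fact_Suc)
  next
    case False
    then have "Suc k div p = k div p"
      by (simp add: div_Suc dvd_eq_mod_eq_0)
    then show ?thesis
      using False by (simp add: Suc_fact Suc.IH not_dvd_imp_multiplicity_0 del: fact_Suc)
  qed
qed

lemma multiplicity_fact_less: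
  assumes "prime (p::nat)" "k > 0"
  shows "multiplicity p (fact k :: nat) < k"
  using assms(2)
proof (induction k rule: less_induct)
  case (less k)
  have p2: "p \<ge> 2" by (rule prime_ge_2_nat[OF assms(1)])
  show ?case
  proof (cases "k div p = 0")
    case True
    then show ?thesis
      using less.prems by (simp add: multiplicity_fact_div[OF assms(1), of k])
  next
    case False
    \<comment> \<open>The recursion now bounds the multiplicity strictly by
      \<open>2 * (k div p)\<close>, which is at most \<open>k\<close> as p is at least 2.\<close>
    then have "multiplicity p (fact (k div p) :: nat) < k div p"
      using less p2 by auto
    moreover have "2 * (k div p) \<le> k"
      using mult_le_mono1[OF p2, of "k div p"] times_div_less_eq_dividend[of p k] by linarith
    ultimately show ?thesis
      by (simp add: multiplicity_fact_div[OF assms(1), of k])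
  qed
qed

text \<open>The exponent \<open>k - 1\<close> in place of \<open>k\<close> leaves a factor p to
  spare when the exponential or the logarithm is evaluated at a multiple of p.\<close>

lemma padic_integers_power_div_fact:
  assumes "k > 0"
  shows "of_nat CARD('p) ^ (k - 1) / fact k \<in> (\<int>\<^sub>p :: 'p::prime_card padic set)"
proof -
  let ?p = "CARD('p)"
  define v where "v = multiplicity ?p (fact k :: nat)"
  have p: "prime ?p" by (rule prime_card)
  have v: "v < k" unfolding v_def by (rule multiplicity_fact_less[OF p assms])
  \<comment> \<open>The factor \<open>m\<close> is prime to p, hence a unit; the p-part divides
    \<open>p ^ (k - 1)\<close> because \<open>v < k\<close>.\<close>
  obtain m where m: "fact k = ?p ^ v * m" "\<not> ?p dvd m"
    using multiplicity_decompose'[of "fact k :: nat" ?p] prime_gt_1_nat[OF p] by (auto simp: v_def)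
  have "fact k = (of_nat ?p ^ v * of_nat m :: 'p padic)"
    by (metis m(1) of_nat_fact of_nat_mult of_nat_power)
  moreover have "of_nat ?p ^ (k - 1) = (of_nat ?p ^ v * of_nat ?p ^ (k - 1 - v) :: 'p padic)"
    using v by (simp flip: power_add)
  ultimately have "of_nat ?p ^ (k - 1) / fact k = (of_nat ?p ^ (k - 1 - v) * inverse (of_nat m) :: 'p padic)"
    by (simp add: divide_inverse)
  then show ?thesis
    using padic_integers_inverse_of_nat[OF m(2)] by (auto simp del: of_nat_power simp flip: of_nat_power)
qed

section \<open>The derivation \<open>\<delta>\<close> and the substitution \<open>z \<mapsto> z ^ p\<close>\<close>

lemma fps_delta_nth [simp]: "fps_nth (fps_delta F) k = of_nat k * fps_nth F k"
  by (cases k) (simp_all add: fps_delta_def)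

lemma fps_delta_power_nth: "fps_nth ((fps_delta ^^ j) F) k = of_nat k ^ j * fps_nth F k"
  by (induction j) (simp_all add: mult.assoc)

lemma fps_delta_0 [simp]: "fps_delta 0 = 0"
  and fps_delta_1 [simp]: "fps_delta 1 = 0"
  and fps_delta_const [simp]: "fps_delta (fps_const c) = 0"
  and fps_delta_add: "fps_delta (F + G) = fps_delta F + fps_delta G"
  and fps_delta_diff: "fps_delta (F - G) = fps_delta F - fps_delta G"
  and fps_delta_uminus: "fps_delta (- F) = - fps_delta F"
  and fps_delta_mult: "fps_delta (F * G) = fps_delta F * G + F * fps_delta G"
  by (simp_all add: fps_delta_def algebra_simps)

lemma fps_delta_power: "fps_delta (F ^ n) = of_nat n * F ^ (n - 1) * fps_delta F"
  by (simp add: fps_delta_def fps_deriv_power' mult_ac)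

lemma fps_delta_compose:
  fixes F :: "'a::idom fps"
  assumes "fps_nth G 0 = 0"
  shows "fps_delta (F oo G) = (fps_deriv F oo G) * fps_delta G"
  by (simp add: fps_delta_def fps_compose_deriv[OF assms] mult_ac)

lemma fps_delta_eq_0_iff:
  fixes F :: "'a::{idom,ring_char_0} fps"
  shows "fps_delta F = 0 \<longleftrightarrow> F = fps_const (fps_nth F 0)"
  by (auto simp: fps_eq_iff) (metis not_gr_zero)

text \<open>The quotient of \<open>F\<close> by \<open>G\<close> has derivative zero, so it is
  constant in characteristic 0.\<close>

lemma fps_delta_proportional:
  fixes F G :: "'a::field_char_0 fps"
  assumes "fps_delta F * G = F * fps_delta G" "fps_nth G 0 \<noteq> 0"
  obtains c where "F = fps_const c * G"
proof -
  define Q where "Q = F * inverse G"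
  have F: "F = Q * G"
    using inverse_mult_eq_1[OF assms(2)] by (simp add: Q_def mult.assoc)
  have "G * G * fps_delta Q = 0"
    using assms(1) unfolding F fps_delta_mult by (simp add: algebra_simps)
  moreover have "G \<noteq> 0" using assms(2) by auto
  ultimately have "Q = fps_const (fps_nth Q 0)"
    by (simp add: fps_delta_eq_0_iff)
  then show ?thesis using F that by metis
qed

lemma fps_delta_proportional_eq:
  fixes F G :: "'a::field_char_0 fps"
  assumes "fps_delta F * G = F * fps_delta G" "fps_nth G 0 \<noteq> 0" "fps_nth F 0 = fps_nth G 0"
  shows "F = G"
  by (rule fps_delta_proportional[OF assms(1,2)]) (use assms(2,3) in auto)

context
  fixes p :: nat
  assumes p: "p > 0"
begin

lemma fps_subst_power_nth:
  "fps_nth (fps_subst_power p F) k = (if p dvd k then fps_nth F (k div p) else 0)"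
  by (simp add: fps_subst_power_def fps_nth_compose_X_power)

lemma fps_subst_power_nth_0 [simp]: "fps_nth (fps_subst_power p F) 0 = fps_nth F 0"
  by (simp add: fps_subst_power_nth)

lemma fps_subst_power_0 [simp]: "fps_subst_power p 0 = 0"
  and fps_subst_power_1 [simp]: "fps_subst_power p 1 = 1"
  and fps_subst_power_const [simp]: "fps_subst_power p (fps_const c) = fps_const c"
  and fps_subst_power_add: "fps_subst_power p (F + G) = fps_subst_power p F + fps_subst_power p G"
  by (simp_all add: fps_subst_power_def fps_compose_add_distrib)

lemma fps_subst_power_mult:
  fixes F :: "'a::idom fps"
  shows "fps_subst_power p (F * G) = fps_subst_power p F * fps_subst_power p G"
  using p by (simp add: fps_subst_power_def fps_compose_mult_distrib)

lemma fps_delta_subst_power: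
  "fps_delta (fps_subst_power p F) = fps_const (of_nat p) * fps_subst_power p (fps_delta F)"
  using p by (auto simp: fps_eq_iff fps_subst_power_nth elim!: dvdE)

end

lemma card_pos: "0 < CARD('p::prime_card)"
  by (simp add: zero_less_card_finite)

section \<open>The ring \<open>\<int>\<^sub>p[[z]]\<close>\<close>

lemma padic_integral_fpsD: "F \<in> \<int>\<^sub>p[[z]] \<Longrightarrow> fps_nth F k \<in> \<int>\<^sub>p"
  by (simp add: padic_integral_fps_def)

lemma padic_integral_fps_add [intro]: "F \<in> \<int>\<^sub>p[[z]] \<Longrightarrow> G \<in> \<int>\<^sub>p[[z]] \<Longrightarrow> F + G \<in> \<int>\<^sub>p[[z]]"
  and padic_integral_fps_diff [intro]: "F \<in> \<int>\<^sub>p[[z]] \<Longrightarrow> G \<in> \<int>\<^sub>p[[z]] \<Longrightarrow> F - G \<in> \<int>\<^sub>p[[z]]"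
  and padic_integral_fps_uminus [intro]: "F \<in> \<int>\<^sub>p[[z]] \<Longrightarrow> - F \<in> \<int>\<^sub>p[[z]]"
  and padic_integral_fps_mult [intro]: "F \<in> \<int>\<^sub>p[[z]] \<Longrightarrow> G \<in> \<int>\<^sub>p[[z]] \<Longrightarrow> F * G \<in> \<int>\<^sub>p[[z]]"
  and padic_integral_fps_const [intro]: "c \<in> \<int>\<^sub>p \<Longrightarrow> fps_const c \<in> \<int>\<^sub>p[[z]]"
  and padic_integral_fps_1 [simp, intro]: "1 \<in> \<int>\<^sub>p[[z]]"
  and padic_integral_fps_0 [simp, intro]: "0 \<in> \<int>\<^sub>p[[z]]"
  and padic_integral_fps_X [simp, intro]: "fps_X \<in> \<int>\<^sub>p[[z]]"
  and padic_integral_fps_delta [intro]: "F \<in> \<int>\<^sub>p[[z]] \<Longrightarrow> fps_delta F \<in> \<int>\<^sub>p[[z]]"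
  and padic_integral_fps_cutoff [intro]: "F \<in> \<int>\<^sub>p[[z]] \<Longrightarrow> fps_cutoff n F \<in> \<int>\<^sub>p[[z]]"
  by (auto simp: padic_integral_fps_def fps_mult_nth fps_X_def)

lemmas padic_integral_fps_intros =
  padic_integral_fps_add padic_integral_fps_diff padic_integral_fps_uminus padic_integral_fps_mult
  padic_integral_fps_const padic_integral_fps_1 padic_integral_fps_0 padic_integral_fps_X
  padic_integral_fps_delta padic_integral_fps_cutoff

lemma padic_integral_fps_power [intro]: "F \<in> \<int>\<^sub>p[[z]] \<Longrightarrow> F ^ n \<in> \<int>\<^sub>p[[z]]"
  by (induction n) auto

lemma padic_integral_fps_sum [intro]:
  "(\<And>i. i \<in> A \<Longrightarrow> F i \<in> \<int>\<^sub>p[[z]]) \<Longrightarrow> sum F A \<in> \<int>\<^sub>p[[z]]"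
  by (induction A rule: infinite_finite_induct) auto

lemma padic_integral_fps_subst_power [intro]:
  fixes F :: "'p::prime_card padic fps"
  shows "F \<in> \<int>\<^sub>p[[z]] \<Longrightarrow> fps_subst_power CARD('p) F \<in> \<int>\<^sub>p[[z]]"
  by (auto simp: padic_integral_fps_def fps_subst_power_nth[OF card_pos])

text \<open>The convolution identity for \<open>F * inverse F = 1\<close> is solved for the k-th
  coefficient of the inverse; only the constant term 1 has to be divided by.\<close>

lemma padic_integral_fps_inverse:
  fixes F :: "'p::prime_card padic fps"
  assumes "F \<in> \<int>\<^sub>p[[z]]" "fps_nth F 0 = 1"
  shows "inverse F \<in> \<int>\<^sub>p[[z]]"
proof -
  have "fps_nth (inverse F) k \<in> \<int>\<^sub>p" for k
  proof (induction k rule: less_induct)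
    case (less k)
    show ?case
    proof (cases "k = 0")
      case False
      have "0 = fps_nth (F * inverse F) k"
        using False inverse_mult_eq_1'[of F] assms(2) by simp
      also have "\<dots> = fps_nth (inverse F) k + (\<Sum>i = 1..k. fps_nth F i * fps_nth (inverse F) (k - i))"
        by (simp add: fps_mult_nth sum.atLeast_Suc_atMost assms(2))
      finally have "fps_nth (inverse F) k = - (\<Sum>i = 1..k. fps_nth F i * fps_nth (inverse F) (k - i))"
        by (simp add: eq_neg_iff_add_eq_0)
      also have "\<dots> \<in> \<int>\<^sub>p"
        using less False assms(1) by (intro padic_integers_uminus padic_integers_sum padic_integers_mult)
          (auto simp: padic_integral_fpsD)
      finally show ?thesis .
    qed (simp add: assms(2))
  qed
  then show ?thesis by (simp add: padic_integral_fps_def)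
qed

text \<open>The coefficient of \<open>z ^ k\<close> on the right-hand side involves the coefficients of \<open>F\<close> up to
  \<open>k / p\<close> only.\<close>

lemma padic_integral_fps_frobenius_recursion:
  fixes F :: "'p::prime_card padic fps"
  assumes "\<And>j. j < n \<Longrightarrow> C j \<in> \<int>\<^sub>p[[z]]" "inverse c \<in> \<int>\<^sub>p" "c \<noteq> 0" "fps_nth F 0 \<in> \<int>\<^sub>p"
    and eq: "fps_const c * F = (\<Sum>j<n. C j * fps_subst_power CARD('p) ((fps_delta ^^ j) F))"
  shows "F \<in> \<int>\<^sub>p[[z]]"
proof -
  have "fps_nth F k \<in> \<int>\<^sub>p" for k
  proof (induction k rule: less_induct)
    case (less k)
    show ?case
    proof (cases "k = 0")
      case False
      have "fps_nth (fps_subst_power CARD('p) ((fps_delta ^^ j) F)) m \<in> \<int>\<^sub>p" if "m \<le> k" for j m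
      proof -
        have "m div CARD('p) < k"
          using that False prime_gt_1_nat[OF prime_card[where 'a = 'p]]
          by (metis div_less_dividend div_le_dividend le_neq_implies_less order.strict_trans1 not_gr_zero)
        then show ?thesis
          using less by (auto simp: fps_subst_power_nth[OF card_pos] fps_delta_power_nth)
      qed
      then have "fps_nth (\<Sum>j<n. C j * fps_subst_power CARD('p) ((fps_delta ^^ j) F)) k \<in> \<int>\<^sub>p"
        using assms(1) unfolding fps_sum_nth fps_mult_nth
        by (intro padic_integers_sum padic_integers_mult) (auto simp: padic_integral_fpsD)
      then have "c * fps_nth F k \<in> \<int>\<^sub>p"
        unfolding eq[symmetric] by simp
      then have "inverse c * (c * fps_nth F k) \<in> \<int>\<^sub>p"
        using assms(2) by blast
      then show ?thesis using assms(3) by (simp add: field_simps)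
    qed (simp add: assms(4))
  qed
  then show ?thesis by (simp add: padic_integral_fps_def)
qed

section \<open>Dwork's criterion\<close>

text \<open>The inner binomial coefficients are divisible by p, and \<open>H\<close> collects the
  quotients.\<close>

lemma padic_freshmans_dream:
  fixes F G :: "'p::prime_card padic fps"
  assumes "F \<in> \<int>\<^sub>p[[z]]" "G \<in> \<int>\<^sub>p[[z]]"
  obtains H where "H \<in> \<int>\<^sub>p[[z]]"
    "(F + G) ^ CARD('p) = F ^ CARD('p) + G ^ CARD('p) + fps_const (of_nat CARD('p)) * H"
proof -
  let ?p = "CARD('p)"
  define H where "H = (\<Sum>k\<in>{1..<?p}. of_nat ((?p choose k) div ?p) * F ^ k * G ^ (?p - k))"
  have "(F + G) ^ ?p = (\<Sum>k\<le>?p. of_nat (?p choose k) * F ^ k * G ^ (?p - k))"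
    by (rule binomial_ring)
  also have "{..?p} = insert 0 (insert ?p {1..<?p})"
    using card_pos[where 'p = 'p] by auto
  also have "(\<Sum>k\<in>insert 0 (insert ?p {1..<?p}). of_nat (?p choose k) * F ^ k * G ^ (?p - k)) =
      F ^ ?p + G ^ ?p + (\<Sum>k\<in>{1..<?p}. of_nat (?p choose k) * F ^ k * G ^ (?p - k))"
    by simp
  also have "(\<Sum>k\<in>{1..<?p}. of_nat (?p choose k) * F ^ k * G ^ (?p - k)) = of_nat ?p * H"
    unfolding H_def sum_distrib_left
  proof (rule sum.cong)
    fix k assume "k \<in> {1..<?p}"
    then have "?p choose k = ?p * ((?p choose k) div ?p)"
      by (intro dvd_mult_div_cancel[symmetric] dvd_choose_prime prime_card) auto
    then have "(of_nat (?p choose k) :: 'p padic fps) = of_nat ?p * of_nat ((?p choose k) div ?p)"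
      by (metis of_nat_mult)
    then show "of_nat (?p choose k) * F ^ k * G ^ (?p - k) =
        of_nat ?p * (of_nat ((?p choose k) div ?p) * F ^ k * G ^ (?p - k))"
      by (simp only: mult.assoc)
  qed simp
  finally have "(F + G) ^ ?p = F ^ ?p + G ^ ?p + fps_const (of_nat ?p) * H"
    by (simp add: fps_of_nat)
  moreover have "H \<in> \<int>\<^sub>p[[z]]"
    unfolding H_def fps_of_nat[symmetric] using assms
    by (intro padic_integral_fps_sum padic_integral_fps_intros padic_integral_fps_power
        padic_integers_of_nat)
  ultimately show ?thesis by (rule that[rotated])
qed

lemma fps_cutoff_Suc: "fps_cutoff (Suc n) F = fps_cutoff n F + fps_const (fps_nth F n) * fps_X ^ n"
  for F :: "'a::comm_ring_1 fps"
  by (auto simp: fps_eq_iff less_Suc_eq)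

text \<open>Factors the difference of m-th powers of \<open>F\<close> and its truncation. The
  cofactor is kept explicit because its constant term gives the coefficient at index
  \<open>n\<close> in \<open>padic_dwork_converse\<close>.\<close>

lemma fps_power_cutoff:
  fixes F :: "'a::comm_ring_1 fps"
  shows "F ^ m = fps_cutoff n F ^ m +
    fps_X ^ n * (fps_shift n F * (\<Sum>i<m. fps_cutoff n F ^ (m - Suc i) * F ^ i))"
proof -
  have "F - fps_cutoff n F = fps_X ^ n * fps_shift n F"
    by (auto simp: fps_eq_iff fps_X_power_mult_nth)
  then have "F ^ m - fps_cutoff n F ^ m =
      fps_X ^ n * fps_shift n F * (\<Sum>i<m. fps_cutoff n F ^ (m - Suc i) * F ^ i)"
    using power_diff_sumr2[of F m "fps_cutoff n F"] by (simp only:)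
  then show ?thesis
    by (simp only: diff_eq_eq mult.assoc add.commute[of "fps_cutoff n F ^ m"])
qed

lemma fps_subst_power_cutoff_nth:
  assumes "q > 0" "k < n"
  shows "fps_nth (fps_subst_power q (fps_cutoff n F)) k = fps_nth (fps_subst_power q F) k"
  using assms(2) order.strict_trans1[OF div_le_dividend, of k n q]
  by (simp add: fps_subst_power_nth[OF assms(1)])

text \<open>For truncations, one monomial is added at a time: \<open>padic_freshmans_dream\<close>
  splits the power and Fermat's theorem treats the monomial. Each coefficient of both sides depends
  on a truncation only.\<close>

lemma padic_frobenius_congruence:
  fixes F :: "'p::prime_card padic fps"
  assumes F: "F \<in> \<int>\<^sub>p[[z]]"
  obtains G where "G \<in> \<int>\<^sub>p[[z]]"
    "F ^ CARD('p) = fps_subst_power CARD('p) F + fps_const (of_nat CARD('p)) * G"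
proof -
  let ?p = "CARD('p)"
  let ?S = "fps_subst_power ?p :: 'p padic fps \<Rightarrow> _"
  let ?c = "fps_const (of_nat ?p) :: 'p padic fps"
  note S = fps_subst_power_add[OF card_pos[where 'p = 'p]]
  have p0: "(of_nat ?p :: 'p padic) \<noteq> 0" by (simp add: zero_less_card_finite)
  have cutoff: "\<exists>G\<in>\<int>\<^sub>p[[z]]. fps_cutoff n F ^ ?p = ?S (fps_cutoff n F) + ?c * G" for n
  proof (induction n)
    case 0
    then show ?case using card_pos by (auto simp: power_0_left intro!: bexI[of _ 0])
  next
    case (Suc n)
    then obtain G where G: "G \<in> \<int>\<^sub>p[[z]]" "fps_cutoff n F ^ ?p = ?S (fps_cutoff n F) + ?c * G"
      by blast
    define a where "a = fps_nth F n"
    define b where "b = (a ^ ?p - a) / of_nat ?p"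
    have b: "b \<in> \<int>\<^sub>p"
      unfolding b_def by (rule padic_integers_fermat) (simp add: a_def F padic_integral_fpsD)
    have M: "fps_const a * fps_X ^ n \<in> \<int>\<^sub>p[[z]]"
      unfolding a_def using F
      by (intro padic_integral_fps_intros padic_integral_fps_power padic_integral_fpsD)
    have "a ^ ?p = a + of_nat ?p * b"
      using p0 by (simp add: b_def)
    then have "(fps_const a * fps_X ^ n) ^ ?p = fps_const (a + of_nat ?p * b) * fps_X ^ (n * ?p)"
      by (simp only: power_mult_distrib fps_const_power power_mult)
    also have "\<dots> = fps_const a * fps_X ^ (n * ?p) + ?c * (fps_const b * fps_X ^ (n * ?p))"
      by (simp add: algebra_simps flip: fps_const_add fps_const_mult)
    also have "fps_const a * fps_X ^ (n * ?p) = ?S (fps_const a * fps_X ^ n)"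
      using card_pos[where 'p = 'p]
      by (auto simp: fps_eq_iff fps_subst_power_nth[OF card_pos] elim!: dvdE)
    finally have mono: "(fps_const a * fps_X ^ n) ^ ?p =
      ?S (fps_const a * fps_X ^ n) + ?c * (fps_const b * fps_X ^ (n * ?p))" .
    obtain H where H: "H \<in> \<int>\<^sub>p[[z]]" "fps_cutoff (Suc n) F ^ ?p =
        fps_cutoff n F ^ ?p + (fps_const a * fps_X ^ n) ^ ?p + ?c * H"
      unfolding fps_cutoff_Suc a_def[symmetric]
      using padic_freshmans_dream[OF padic_integral_fps_cutoff[OF F] M] by blast
    have SC: "?S (fps_cutoff (Suc n) F) = ?S (fps_cutoff n F) + ?S (fps_const a * fps_X ^ n)"
      by (simp only: fps_cutoff_Suc S a_def)
    have "fps_cutoff (Suc n) F ^ ?p = ?S (fps_cutoff (Suc n) F) +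
        ?c * (G + fps_const b * fps_X ^ (n * ?p) + H)"
      unfolding H(2) mono G(2) SC by (simp add: algebra_simps)
    then show ?case using G(1) H(1) b by blast
  qed
  \<comment> \<open>The quotient exists over the field; its k-th coefficient is that of the integral
    \<open>H\<close> belonging to the truncation at \<open>Suc k\<close>.\<close>
  define G where "G = fps_const (1 / of_nat ?p) * (F ^ ?p - ?S F)"
  have "fps_nth G k \<in> \<int>\<^sub>p" for k
  proof -
    obtain H where H: "H \<in> \<int>\<^sub>p[[z]]"
      "fps_cutoff (Suc k) F ^ ?p = ?S (fps_cutoff (Suc k) F) + ?c * H"
      using cutoff by blast
    have "fps_nth (F ^ ?p) k = fps_nth (fps_cutoff (Suc k) F ^ ?p) k"
      by (subst fps_power_cutoff[of F ?p "Suc k"]) (simp add: fps_X_power_mult_nth del: power_Suc)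
    also have "\<dots> = fps_nth (?S F) k + of_nat ?p * fps_nth H k"
      by (simp add: H(2) fps_subst_power_cutoff_nth card_pos)
    finally have "fps_nth G k = fps_nth H k"
      using p0 by (simp add: G_def)
    then show ?thesis using H(1) by (simp add: padic_integral_fpsD)
  qed
  then have "G \<in> \<int>\<^sub>p[[z]]" by (simp add: padic_integral_fps_def)
  moreover have "?c * fps_const (1 / of_nat ?p) = 1"
    using p0 by (simp add: fps_const_mult)
  then have "F ^ ?p = ?S F + ?c * G"
    unfolding G_def mult.assoc[symmetric] by simp
  ultimately show ?thesis by (rule that)
qed

text \<open>Strong induction on the index. At \<open>z ^ k\<close>, with \<open>T\<close> the
  truncation below \<open>k\<close>, the unknown coefficient enters multiplied by p, and by the
  Frobenius congruence for \<open>T\<close> all other terms add up to p times an integral value, so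
  p cancels.\<close>

lemma padic_dwork_converse:
  fixes F :: "'p::prime_card padic fps"
  assumes F0: "fps_nth F 0 = 1" and W: "W \<in> \<int>\<^sub>p[[z]]" "fps_nth W 0 = 0"
    and eq: "fps_subst_power CARD('p) F = F ^ CARD('p) * (1 + fps_const (of_nat CARD('p)) * W)"
  shows "F \<in> \<int>\<^sub>p[[z]]"
proof -
  let ?p = "CARD('p)"
  have p0: "(of_nat ?p :: 'p padic) \<noteq> 0" by (simp add: zero_less_card_finite)
  have "fps_nth F k \<in> \<int>\<^sub>p" for k
  proof (induction k rule: less_induct)
    case (less k)
    show ?case
    proof (cases "k = 0")
      case False
      define T where "T = fps_cutoff k F"
      have T: "T \<in> \<int>\<^sub>p[[z]]" using less by (simp add: T_def padic_integral_fps_def)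
      have T0: "fps_nth T 0 = 1" using False F0 by (simp add: T_def)
      obtain V where V: "V \<in> \<int>\<^sub>p[[z]]"
        "T ^ ?p = fps_subst_power ?p T + fps_const (of_nat ?p) * V"
        using padic_frobenius_congruence[OF T] by blast
      have low: "fps_nth (F ^ ?p) i = fps_nth (T ^ ?p) i" if "i < k" for i
        using that by (subst fps_power_cutoff[of F ?p k]) (simp add: fps_X_power_mult_nth T_def)
      \<comment> \<open>All constant terms are 1, so the cofactor in \<open>fps_power_cutoff\<close>
        has constant term \<open>fps_nth F k\<close> times the number p of summands.\<close>
      have "fps_nth (F ^ ?p) k = fps_nth (T ^ ?p) k + fps_nth F k * of_nat ?p"
        by (subst fps_power_cutoff[of F ?p k])
          (simp add: fps_X_power_mult_nth T_def[symmetric] fps_sum_nth fps_power_zeroth_eq_one F0 T0)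
      also have "fps_nth (T ^ ?p) k = fps_nth (fps_subst_power ?p F) k + of_nat ?p * fps_nth V k"
      proof -
        have "k div ?p < k"
          using False prime_gt_1_nat[OF prime_card[where 'a = 'p]] by simp
        then show ?thesis
          unfolding V(2) by (simp add: T_def fps_subst_power_nth[OF card_pos])
      qed
      also have "fps_nth (fps_subst_power ?p F) k =
          fps_nth (F ^ ?p) k + of_nat ?p * fps_nth (F ^ ?p * W) k"
        unfolding eq by (simp add: distrib_left mult.left_commute[of "F ^ ?p"])
      finally have "of_nat ?p * fps_nth F k = of_nat ?p * (- fps_nth V k - fps_nth (F ^ ?p * W) k)"
        by (simp add: algebra_simps eq_neg_iff_add_eq_0)
      then have "fps_nth F k = - fps_nth V k - fps_nth (F ^ ?p * W) k"
        using p0 by simp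
      \<comment> \<open>The two powers can differ only at \<open>i = k\<close>, where the factor
        from \<open>W\<close> is its constant term 0.\<close>
      also have "fps_nth (F ^ ?p * W) k = fps_nth (T ^ ?p * W) k"
        unfolding fps_mult_nth
      proof (rule sum.cong)
        fix i assume "i \<in> {0..k}"
        then show "fps_nth (F ^ ?p) i * fps_nth W (k - i) = fps_nth (T ^ ?p) i * fps_nth W (k - i)"
          using low[of i] W(2) by (cases "i = k") auto
      qed simp
      also have "- fps_nth V k - fps_nth (T ^ ?p * W) k \<in> \<int>\<^sub>p"
        using T V(1) W(1) by (intro padic_integers_diff padic_integers_uminus padic_integral_fpsD) auto
      finally show ?thesis .
    qed (simp add: F0)
  qed
  then show ?thesis by (simp add: padic_integral_fps_def)
qed

section \<open>Exponential and logarithm of multiples of p\<close>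

text \<open>The i-th term carries \<open>p ^ i\<close>: the assumption absorbs
  \<open>p ^ (i - 1)\<close>, and the remaining p is pulled out of the sum over positive
  \<open>i\<close>.\<close>

lemma padic_compose_multiple:
  fixes F G :: "'p::prime_card padic fps"
  assumes F: "\<And>i. i > 0 \<Longrightarrow> of_nat CARD('p) ^ (i - 1) * fps_nth F i \<in> \<int>\<^sub>p"
    and G: "G \<in> \<int>\<^sub>p[[z]]"
  obtains W where "W \<in> \<int>\<^sub>p[[z]]"
    "F oo (fps_const (of_nat CARD('p)) * G) = fps_const (fps_nth F 0) + fps_const (of_nat CARD('p)) * W"
proof -
  let ?q = "of_nat CARD('p) :: 'p padic"
  define W where "W = Abs_fps (\<lambda>k. \<Sum>i = 1..k. ?q ^ (i - 1) * fps_nth F i * fps_nth (G ^ i) k)"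
  have "W \<in> \<int>\<^sub>p[[z]]"
    using padic_integers_mult[OF F padic_integral_fpsD[OF padic_integral_fps_power[OF G]]]
    unfolding padic_integral_fps_def W_def by (auto intro!: padic_integers_sum)
  moreover have "F oo (fps_const ?q * G) = fps_const (fps_nth F 0) + fps_const ?q * W"
  proof (rule fps_ext)
    fix k
    have "(\<Sum>i = 1..k. fps_nth F i * fps_nth ((fps_const ?q * G) ^ i) k) = ?q * fps_nth W k"
      unfolding W_def sum_distrib_left fps_nth_Abs_fps
    proof (rule sum.cong)
      fix i assume "i \<in> {1..k}"
      then have "?q ^ i = ?q * ?q ^ (i - 1)" by (cases i) auto
      then show "fps_nth F i * fps_nth ((fps_const ?q * G) ^ i) k =
          ?q * (?q ^ (i - 1) * fps_nth F i * fps_nth (G ^ i) k)"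
        by (simp add: power_mult_distrib fps_const_power mult_ac)
    qed simp
    then show "fps_nth (F oo (fps_const ?q * G)) k =
        fps_nth (fps_const (fps_nth F 0) + fps_const ?q * W) k"
      by (simp add: fps_compose_nth sum.atLeast_Suc_atMost)
  qed
  ultimately show ?thesis by (rule that)
qed

lemma padic_exp_multiple:
  fixes G :: "'p::prime_card padic fps"
  assumes "G \<in> \<int>\<^sub>p[[z]]"
  obtains W where "W \<in> \<int>\<^sub>p[[z]]" "fps_nth W 0 = 0"
    "fps_exp 1 oo (fps_const (of_nat CARD('p)) * G) = 1 + fps_const (of_nat CARD('p)) * W"
proof -
  obtain W where W: "W \<in> \<int>\<^sub>p[[z]]"
    "fps_exp 1 oo (fps_const (of_nat CARD('p)) * G) = 1 + fps_const (of_nat CARD('p)) * W"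
    using padic_compose_multiple[of "fps_exp 1" G] assms padic_integers_power_div_fact
    by auto
  moreover have "fps_nth W 0 = 0"
    using arg_cong[OF W(2), of "\<lambda>F. fps_nth F 0"] by (simp add: zero_less_card_finite)
  ultimately show ?thesis using that by blast
qed

lemma padic_ln_multiple:
  fixes G :: "'p::prime_card padic fps"
  assumes "G \<in> \<int>\<^sub>p[[z]]"
  obtains W where "W \<in> \<int>\<^sub>p[[z]]"
    "fps_ln 1 oo (fps_const (of_nat CARD('p)) * G) = fps_const (of_nat CARD('p)) * W"
proof -
  have "of_nat CARD('p) ^ (i - 1) * fps_nth (fps_ln 1) i \<in> (\<int>\<^sub>p :: 'p padic set)" if "i > 0" for i
  proof -
    \<comment> \<open>Up to sign the coefficient is \<open>1 / i\<close>, that is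
      \<open>fact (i - 1) / fact i\<close>, so the bound for factorials suffices.\<close>
    have "(of_nat CARD('p) ^ (i - 1) * fps_nth (fps_ln 1) i :: 'p padic) =
        (- 1) ^ (i - 1) * (of_nat (fact (i - 1)) * (of_nat CARD('p) ^ (i - 1) / fact i))"
      using that by (simp add: fps_ln_nth fact_reduce[of i] field_simps)
    then show ?thesis
      using padic_integers_power_div_fact[OF that, where 'p = 'p]
      by (metis padic_integers_1 padic_integers_mult padic_integers_of_nat padic_integers_power
          padic_integers_uminus)
  qed
  then show ?thesis
    using padic_compose_multiple[of "fps_ln 1" G] assms that by auto
qed

section \<open>Logarithmic derivatives and the integrality criterion\<close>

lemma fps_delta_exp_compose:
  fixes F :: "'a::field_char_0 fps"
  assumes "fps_nth F 0 = 0"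
  shows "fps_delta (fps_exp 1 oo F) = (fps_exp 1 oo F) * fps_delta F"
  by (simp add: fps_delta_compose[OF assms])

lemma fps_delta_ln_compose:
  fixes F :: "'a::field_char_0 fps"
  assumes "fps_nth F 0 = 0"
  shows "(1 + F) * fps_delta (fps_ln 1 oo F) = fps_delta F"
proof -
  have "((1 + fps_X) * inverse (1 + fps_X) :: 'a fps) oo F = 1 oo F"
    by (subst inverse_mult_eq_1') simp_all
  then have "(1 + F) * (inverse (1 + fps_X) oo F) = 1"
    by (simp add: fps_compose_mult_distrib assms fps_compose_add_distrib)
  then show ?thesis
    by (simp add: fps_delta_compose[OF assms] fps_ln_deriv mult.assoc[symmetric])
qed

text \<open>This is the logarithmic derivative of \<open>E(z^q) / E^q\<close>, cleared of
  denominators; it equals \<open>delta (R(z^q) - q R)\<close>.\<close>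

lemma fps_delta_frobenius_quotient:
  fixes R :: "'a::field_char_0 fps"
  assumes "q > 0" "fps_nth R 0 = 0"
  defines "E \<equiv> fps_exp 1 oo R"
  shows "fps_delta (fps_subst_power q E) * E ^ q =
    fps_subst_power q E * (fps_delta (E ^ q) +
      E ^ q * fps_delta (fps_subst_power q R - fps_const (of_nat q) * R))"
proof -
  have E: "fps_delta E = E * fps_delta R"
    unfolding E_def by (rule fps_delta_exp_compose[OF assms(2)])
  have Eq: "fps_delta (E ^ q) = fps_const (of_nat q) * (E ^ q * fps_delta R)"
    using power_minus_mult[OF assms(1), of E]
    by (simp only: fps_delta_power E fps_of_nat) (simp add: mult_ac)
  show ?thesis
    unfolding Eq fps_delta_subst_power[OF assms(1)] E fps_subst_power_mult[OF assms(1)]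
      fps_delta_diff fps_delta_mult
    by (simp add: fps_delta_subst_power[OF assms(1)] algebra_simps)
qed

text \<open>The quotient \<open>E(z^p) / E^p\<close> is the exponential of
  \<open>R(z^p) - p R\<close>. If \<open>E\<close> is integral, it is 1 modulo p and its logarithm
  is p times an integral series; conversely, the exponential of \<open>p G\<close> is 1 modulo p and
  \<open>padic_dwork_converse\<close> applies.\<close>

lemma dieudonne_dwork_exp:
  fixes R :: "'p::prime_card padic fps"
  assumes R0: "fps_nth R 0 = 0"
  shows "fps_exp 1 oo R \<in> \<int>\<^sub>p[[z]] \<longleftrightarrow>
    (\<exists>G\<in>\<int>\<^sub>p[[z]]. fps_subst_power CARD('p) R - fps_const (of_nat CARD('p)) * R =
      fps_const (of_nat CARD('p)) * G)"
proof
  let ?p = "CARD('p)"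
  let ?S = "fps_subst_power ?p :: 'p padic fps \<Rightarrow> _"
  let ?c = "fps_const (of_nat ?p) :: 'p padic fps"
  define E where "E = fps_exp 1 oo R"
  have E0: "fps_nth E 0 = 1" by (simp add: E_def)
  note S0 = fps_subst_power_nth_0[OF card_pos[where 'p = 'p]]
  note quot = fps_delta_frobenius_quotient[OF card_pos[where 'p = 'p] R0, folded E_def]
  {
    assume "fps_exp 1 oo R \<in> \<int>\<^sub>p[[z]]"
    then have E: "E \<in> \<int>\<^sub>p[[z]]" by (simp add: E_def)
    then obtain G where G: "G \<in> \<int>\<^sub>p[[z]]" "E ^ ?p = ?S E + ?c * G"
      by (rule padic_frobenius_congruence)
    \<comment> \<open>Chosen so that \<open>1 + p W\<close> is \<open>E(z^p) / E^p\<close>.\<close>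
    define W where "W = - G * inverse (E ^ ?p)"
    have Ep0: "fps_nth (E ^ ?p) 0 = 1" by (simp add: E0 fps_power_zeroth_eq_one)
    have W: "W \<in> \<int>\<^sub>p[[z]]"
      unfolding W_def using E Ep0 G(1)
      by (intro padic_integral_fps_mult padic_integral_fps_uminus padic_integral_fps_inverse) auto
    have inv: "E ^ ?p * inverse (E ^ ?p) = 1"
      by (rule inverse_mult_eq_1') (simp add: Ep0)
    have SE: "?S E = E ^ ?p * (1 + ?c * W)"
    proof -
      have "E ^ ?p * (1 + ?c * W) = E ^ ?p - ?c * G * (E ^ ?p * inverse (E ^ ?p))"
        by (simp add: W_def algebra_simps)
      then show ?thesis using G(2) inv by simp
    qed
    have W0: "fps_nth (?c * W) 0 = 0"
      using arg_cong[OF SE, of "\<lambda>F. fps_nth F 0"] by (simp add: S0 Ep0 E0)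
    obtain V where V: "V \<in> \<int>\<^sub>p[[z]]" "fps_ln 1 oo (?c * W) = ?c * V"
      by (rule padic_ln_multiple[OF W])
    \<comment> \<open>The aim is \<open>D = ?c * V\<close>: both have constant term 0, and the
      derivative of each is the logarithmic derivative of \<open>1 + p W\<close>.\<close>
    define D where "D = ?S R - ?c * R"
    define U where "U = 1 + ?c * W"
    define P where "P = E ^ ?p"
    have "fps_delta (P * U) * P = P * U * (fps_delta P + P * fps_delta D)"
      using quot unfolding SE P_def U_def D_def .
    then have "P * P * fps_delta U = P * P * (U * fps_delta D)"
      by (simp add: fps_delta_mult algebra_simps)
    moreover have "P \<noteq> 0" using Ep0 unfolding P_def by force
    ultimately have "fps_delta U = U * fps_delta D" by simp
    moreover have "U * fps_delta (?c * V) = fps_delta U"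
      unfolding U_def V(2)[symmetric] using fps_delta_ln_compose[OF W0] by (simp add: fps_delta_add)
    ultimately have "U * (fps_delta D - fps_delta (?c * V)) = 0"
      by (simp only: right_diff_distrib diff_self)
    moreover have "U \<noteq> 0"
      using W0 by (auto simp: U_def fps_eq_iff intro!: exI[of _ 0])
    ultimately have "fps_delta (D - ?c * V) = 0" by (simp add: fps_delta_diff)
    moreover have "fps_nth (D - ?c * V) 0 = 0"
      unfolding V(2)[symmetric] by (simp add: D_def S0 R0)
    ultimately have "D = ?c * V"
      by (simp add: fps_delta_eq_0_iff)
    then show "\<exists>G\<in>\<int>\<^sub>p[[z]]. ?S R - ?c * R = ?c * G"
      using V(1) unfolding D_def by blast
  next
    assume "\<exists>G\<in>\<int>\<^sub>p[[z]]. ?S R - ?c * R = ?c * G"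
    then obtain G where G: "G \<in> \<int>\<^sub>p[[z]]" "?S R - ?c * R = ?c * G" by blast
    obtain W where W: "W \<in> \<int>\<^sub>p[[z]]" "fps_nth W 0 = 0" "fps_exp 1 oo (?c * G) = 1 + ?c * W"
      by (rule padic_exp_multiple[OF G(1)])
    have G0: "fps_nth (?c * G) 0 = 0"
      using arg_cong[OF G(2), of "\<lambda>F. fps_nth F 0"] by (simp add: S0 R0)
    have "?S E = E ^ ?p * (1 + ?c * W)"
    \<comment> \<open>Both sides have constant term 1 and the same logarithmic derivative.\<close>
    proof (rule fps_delta_proportional_eq)
      define T where "T = fps_exp 1 oo (?c * G)"
      have "fps_delta T = T * fps_delta (?c * G)"
        unfolding T_def by (rule fps_delta_exp_compose[OF G0])
      then have "fps_delta (?S E) * (E ^ ?p * T) = ?S E * fps_delta (E ^ ?p * T)"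
        using quot unfolding G(2) fps_delta_mult[of "E ^ ?p"] by (simp add: algebra_simps)
      then show "fps_delta (?S E) * (E ^ ?p * (1 + ?c * W)) = ?S E * fps_delta (E ^ ?p * (1 + ?c * W))"
        by (simp only: T_def W(3))
    qed (simp_all add: E0 S0 W(2) fps_power_zeroth_eq_one)
    then have "E \<in> \<int>\<^sub>p[[z]]"
      by (rule padic_dwork_converse[OF E0 W(1,2)])
    then show "fps_exp 1 oo R \<in> \<int>\<^sub>p[[z]]" by (simp add: E_def)
  }
qed

section \<open>Operators on logarithmic series\<close>

lemma log_delta_pair: "log_delta [:a, b:] = [:fps_delta a + b, fps_delta b:]"
  by (simp add: log_delta_def Polynomial.map_poly_pCons pderiv_pCons)

lemma log_delta_power_const: "(log_delta ^^ i) [:a:] = [:(fps_delta ^^ i) a:]"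
  by (induction i) (simp_all add: log_delta_def Polynomial.map_poly_pCons pderiv_pCons)

lemma diffop_apply_const:
  "diffop_apply P [:a:] = [:\<Sum>i\<le>degree P. coeff P i * (fps_delta ^^ i) a:]"
proof -
  have "(\<Sum>i\<in>A. [:u i:]) = [:\<Sum>i\<in>A. u i:]" for u :: "nat \<Rightarrow> 'a fps" and A
    by (induction A rule: infinite_finite_induct) simp_all
  then show ?thesis
    by (simp add: diffop_apply_def log_delta_power_const)
qed

text \<open>A uniform summation bound, so that \<open>[:A, B:]\<close> with \<open>B = 0\<close>
  needs no case distinction.\<close>

lemma diffop_apply_le_degree:
  assumes "degree P \<le> N"
  shows "diffop_apply P y = (\<Sum>i\<le>N. smult (coeff P i) ((log_delta ^^ i) y))"
  unfolding diffop_apply_def using assms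
  by (intro sum.mono_neutral_left) (auto simp: coeff_eq_0)

lemma diffop_apply_order_1:
  "diffop_apply [:A, B:] [:a, b:] = [:A * a + B * (fps_delta a + b), A * b + B * fps_delta b:]"
  by (subst diffop_apply_le_degree[of _ 1]) (simp_all add: log_delta_pair)

lemma log_subst_power_pair:
  assumes "p > 0"
  shows "log_subst_power p [:a, b:] = [:fps_subst_power p a, of_nat p * fps_subst_power p b:]"
  by (simp add: log_subst_power_def Polynomial.map_poly_pCons fps_subst_power_0[OF assms] pcompose_pCons mult.commute)

lemma degree_le_1E:
  assumes "degree y \<le> 1"
  obtains a b where "y = [:a, b:]"
proof
  show "y = [:coeff y 0, coeff y 1:]"
    using assms by (intro poly_eqI) (auto simp: coeff_pCons coeff_eq_0 split: nat.splits)
qed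

section \<open>Solutions of the second-order operator\<close>

text \<open>Here \<open>u\<close> and \<open>v\<close> are the power series part and the
  \<open>log z\<close> coefficient of \<open>(delta - t1) y\<close>; applying
  \<open>delta - t2\<close> repeats the same rule.\<close>

lemma diffop_apply_product_order_2:
  fixes a b t1 t2 :: "'a::field_char_0 fps"
  defines "u \<equiv> fps_delta a + b - t1 * a" and "v \<equiv> fps_delta b - t1 * b"
  shows "diffop_apply (diffop_mult [:- t2, 1:] [:- t1, 1:]) [:a, b:] =
    [:fps_delta u + v - t2 * u, fps_delta v - t2 * v:]"
proof -
  have "diffop_mult [:- t2, 1:] [:- t1, 1:] = [:t2 * t1 - fps_delta t1, - t2 - t1, 1:]"
    by (simp add: diffop_mult_def delta_times_def Polynomial.map_poly_pCons fps_delta_uminus)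
  moreover have "diffop_apply [:A, B, 1:] [:a, b:] =
      [:A * a, A * b:] + [:B * (fps_delta a + b), B * fps_delta b:] +
      [:fps_delta (fps_delta a + b) + fps_delta b, fps_delta (fps_delta b):]" for A B
    by (subst diffop_apply_le_degree[of _ 2])
      (simp_all add: numeral_2_eq_2 log_delta_pair)
  ultimately show ?thesis
    by (simp add: u_def v_def fps_delta_add fps_delta_diff fps_delta_mult algebra_simps)
qed

lemma fps_divide_times_unit:
  fixes F G :: "'a::field fps"
  assumes "fps_nth G 0 \<noteq> 0"
  shows "F / G * G = F"
  using inverse_mult_eq_1[OF assms] by (simp add: fps_divide_unit[OF assms] mult.assoc)

text \<open>The factor \<open>delta - t1\<close> kills \<open>y_0\<close> and sends
  \<open>y_1\<close> to \<open>h\<close>, which \<open>delta - t2\<close> kills. Conversely, the two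
  first-order equations are solved in turn, and constant terms relate the integration
  constants.\<close>

lemma second_order_solution_iff:
  fixes f g :: "'a::field_char_0 fps"
  assumes f0: "fps_nth f 0 = 1" and g0: "fps_nth g 0 = 0"
  shows "is_log_solution (second_order_diffop f g) y \<longleftrightarrow>
    (\<exists>c0 c1. y = [:fps_const c0 * f + fps_const c1 * g, fps_const c1 * f:])"
proof -
  define t1 where "t1 = fps_delta f / f"
  define h where "h = f + fps_delta g - t1 * g"
  define t2 where "t2 = fps_delta h / h"
  have L2: "second_order_diffop f g = diffop_mult [:- t2, 1:] [:- t1, 1:]"
    by (simp add: second_order_diffop_def Let_def t1_def t2_def h_def)
  have h0: "fps_nth h 0 = 1" by (simp add: h_def f0 g0)
  have t1: "t1 * f = fps_delta f" and t2: "t2 * h = fps_delta h"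
    unfolding t1_def t2_def by (rule fps_divide_times_unit, simp add: f0 h0)+
  have t0: "fps_nth t1 0 = 0" "fps_nth t2 0 = 0"
    using arg_cong[OF t1, of "\<lambda>F. fps_nth F 0"] arg_cong[OF t2, of "\<lambda>F. fps_nth F 0"]
    by (simp_all add: f0 h0)
  have first_order: "\<exists>c. x = fps_const c * k"
    if "fps_delta x = t * x" "t * k = fps_delta k" "fps_nth k 0 = 1" for x t k :: "'a fps"
  proof -
    have "fps_delta x * k = x * fps_delta k"
      unfolding that(1) that(2)[symmetric] by (simp add: mult_ac)
    then show ?thesis using that(3) by (elim fps_delta_proportional) auto
  qed
  show ?thesis
  proof
    assume "is_log_solution (second_order_diffop f g) y"
    then obtain a b where y: "y = [:a, b:]" and "diffop_apply (second_order_diffop f g) [:a, b:] = 0"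
      unfolding is_log_solution_def by (metis degree_le_1E)
    moreover define u where "u = fps_delta a + b - t1 * a"
    moreover define v where "v = fps_delta b - t1 * b"
    ultimately have u: "fps_delta u + v = t2 * u" and v: "fps_delta v = t2 * v"
      by (simp_all add: L2 diffop_apply_product_order_2)
    obtain c where c: "v = fps_const c * h" using first_order[OF v t2 h0] ..
    \<comment> \<open>At \<open>z = 0\<close> the equation for \<open>u\<close> reads
      \<open>c = 0\<close>; thus \<open>(delta - t1) y\<close> contains no logarithm.\<close>
    have "c = 0"
      using arg_cong[OF u, of "\<lambda>F. fps_nth F 0"] by (simp add: c h0 t0)
    then have v0: "v = 0" by (simp add: c)
    then have "fps_delta u = t2 * u" using u by simp
    then obtain c1 where c1: "u = fps_const c1 * h" using first_order[OF _ t2 h0] by blast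
    have "fps_delta b = t1 * b" using v0 by (simp add: v_def)
    then obtain d where d: "b = fps_const d * f" using first_order[OF _ t1 f0] by blast
    have "d = c1"
      using arg_cong[OF c1, of "\<lambda>F. fps_nth F 0"] by (simp add: u_def d f0 h0 t0)
    have "fps_delta a = t1 * a + fps_const c1 * (fps_delta g - t1 * g)"
      using c1 by (simp add: u_def h_def d \<open>d = c1\<close> algebra_simps)
    then have "fps_delta (a - fps_const c1 * g) = t1 * (a - fps_const c1 * g)"
      by (simp add: fps_delta_diff fps_delta_mult algebra_simps)
    then obtain c0 where "a - fps_const c1 * g = fps_const c0 * f"
      using first_order[OF _ t1 f0] by blast
    then have "a = fps_const c0 * f + fps_const c1 * g" by (simp add: algebra_simps)
    then show "\<exists>c0 c1. y = [:fps_const c0 * f + fps_const c1 * g, fps_const c1 * f:]"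
      using y d \<open>d = c1\<close> by blast
  next
    assume "\<exists>c0 c1. y = [:fps_const c0 * f + fps_const c1 * g, fps_const c1 * f:]"
    then obtain c0 c1 where y: "y = [:fps_const c0 * f + fps_const c1 * g, fps_const c1 * f:]"
      by blast
    have u: "fps_delta (fps_const c0 * f + fps_const c1 * g) + fps_const c1 * f -
        t1 * (fps_const c0 * f + fps_const c1 * g) = fps_const c1 * h"
      by (simp add: fps_delta_add fps_delta_mult t1[symmetric] h_def algebra_simps)
    have v: "fps_delta (fps_const c1 * f) - t1 * (fps_const c1 * f) = 0"
      by (simp add: fps_delta_mult t1[symmetric] algebra_simps)
    have "diffop_apply (second_order_diffop f g) y = 0"
      unfolding L2 y diffop_apply_product_order_2 u v
      by (simp add: fps_delta_mult t2[symmetric] algebra_simps)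
    then show "is_log_solution (second_order_diffop f g) y"
      by (simp add: is_log_solution_def y)
  qed
qed

text \<open>By linearity it suffices to test \<open>y_0\<close> and \<open>y_1\<close>. Their images
  are solutions, and the logarithmic coefficients together with the constant terms, fixed by
  \<open>B1(0) = 1\<close> and \<open>B2(0) = 0\<close>, identify them as \<open>y_0\<close> and
  \<open>p y_1\<close>.\<close>

lemma frobenius_operator_iff:
  fixes f g B1 B2 :: "'a::field_char_0 fps"
  assumes f0: "fps_nth f 0 = 1" and g0: "fps_nth g 0 = 0" and p: "p > 0"
    and B: "fps_nth B1 0 = 1" "fps_nth B2 0 = 0"
  defines "S \<equiv> fps_subst_power p"
  shows "(\<forall>y. is_log_solution (second_order_diffop f g) y \<longrightarrow>
      is_log_solution (second_order_diffop f g) (diffop_apply [:B1, B2:] (log_subst_power p y))) \<longleftrightarrow>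
    B1 * S f + B2 * fps_delta (S f) = f \<and>
    B1 * S g + B2 * (fps_delta (S g) + fps_const (of_nat p) * S f) = fps_const (of_nat p) * g"
    (is "?L \<longleftrightarrow> ?E1 \<and> ?E2")
proof -
  note S0 = fps_subst_power_nth_0[OF p]
  have image: "diffop_apply [:B1, B2:] (log_subst_power p
      [:fps_const c0 * f + fps_const c1 * g, fps_const c1 * f:]) =
    [:fps_const c0 * (B1 * S f + B2 * fps_delta (S f)) +
      fps_const c1 * (B1 * S g + B2 * (fps_delta (S g) + fps_const (of_nat p) * S f)),
      fps_const c1 * fps_const (of_nat p) * (B1 * S f + B2 * fps_delta (S f)):]" for c0 c1
    unfolding log_subst_power_pair[OF p] diffop_apply_order_1 S_def fps_of_nat[symmetric]
      fps_subst_power_add[OF p] fps_subst_power_mult[OF p] fps_subst_power_const[OF p]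
    by (simp only: fps_delta_add fps_delta_mult fps_delta_const)
      (simp add: algebra_simps flip: fps_const_mult)
  show ?thesis
  proof
    assume L: ?L
    have sol: "\<exists>d0 d1. diffop_apply [:B1, B2:] (log_subst_power p
        [:fps_const c0 * f + fps_const c1 * g, fps_const c1 * f:]) =
        [:fps_const d0 * f + fps_const d1 * g, fps_const d1 * f:]" for c0 c1
      using L unfolding second_order_solution_iff[OF f0 g0] by blast
    have E1: ?E1
    proof -
      obtain d0 d1 where d: "B1 * S f + B2 * fps_delta (S f) = fps_const d0 * f + fps_const d1 * g"
        "fps_const d1 * f = 0"
        using sol[of 1 0] unfolding image by auto
      have "d1 = 0"
        using arg_cong[OF d(2), of "\<lambda>F. fps_nth F 0"] by (simp add: f0)
      moreover from this have "d0 = 1"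
        using arg_cong[OF d(1), of "\<lambda>F. fps_nth F 0"] by (simp add: S_def S0 f0 B)
      ultimately show ?thesis using d(1) by simp
    qed
    have ?E2
    proof -
      obtain d0 d1 where d: "B1 * S g + B2 * (fps_delta (S g) + fps_const (of_nat p) * S f) =
          fps_const d0 * f + fps_const d1 * g" "fps_const (of_nat p) * f = fps_const d1 * f"
        using sol[of 0 1] unfolding image E1 by auto
      have "d1 = of_nat p"
        using arg_cong[OF d(2), of "\<lambda>F. fps_nth F 0"] by (simp add: f0)
      moreover have "d0 = 0"
        using arg_cong[OF d(1), of "\<lambda>F. fps_nth F 0"] by (simp add: S_def S0 f0 g0 B)
      ultimately show ?thesis using d(1) by simp
    qed
    with E1 show "?E1 \<and> ?E2" ..
  next
    assume E: "?E1 \<and> ?E2"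
    show ?L
      unfolding second_order_solution_iff[OF f0 g0]
    proof (intro allI impI)
      fix y assume "\<exists>c0 c1. y = [:fps_const c0 * f + fps_const c1 * g, fps_const c1 * f:]"
      then obtain c0 c1 where y: "y = [:fps_const c0 * f + fps_const c1 * g, fps_const c1 * f:]"
        by blast
      have "diffop_apply [:B1, B2:] (log_subst_power p y) =
        [:fps_const c0 * f + fps_const (c1 * of_nat p) * g, fps_const (c1 * of_nat p) * f:]"
        unfolding y image E[THEN conjunct1] E[THEN conjunct2]
        by (simp add: mult.assoc flip: fps_const_mult)
      then show "\<exists>c0 c1. diffop_apply [:B1, B2:] (log_subst_power p y) =
          [:fps_const c0 * f + fps_const c1 * g, fps_const c1 * f:]"
        by blast
    qed
  qed
qed

section \<open>Frobenius operators and the canonical coordinate\<close>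

text \<open>With \<open>C = B2 * S f / f\<close>, elimination of \<open>B1\<close> gives
  \<open>S R - p R = - p C S U\<close>. The integrality of \<open>U\<close> is extracted from the
  derivative of this same relation.\<close>

lemma canonical_coordinate_integral_of_frobenius_operator:
  fixes f R B1 B2 :: "'p::prime_card padic fps"
  defines "S \<equiv> fps_subst_power CARD('p)" and "c \<equiv> fps_const (of_nat CARD('p))"
  assumes f0: "fps_nth f 0 = 1" and R0: "fps_nth R 0 = 0"
    and B: "B1 \<in> \<int>\<^sub>p[[z]]" "B2 \<in> \<int>\<^sub>p[[z]]"
    and E1: "B1 * S f + B2 * fps_delta (S f) = f"
    and E2: "B1 * S (R * f) + B2 * (fps_delta (S (R * f)) + c * S f) = c * (R * f)"
  shows "fps_exp 1 oo R \<in> \<int>\<^sub>p[[z]]"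
proof -
  have S_mult: "S (F * G) = S F * S G" for F G by (simp add: S_def fps_subst_power_mult)
  have delta_S: "fps_delta (S F) = c * S (fps_delta F)" for F
    by (simp add: S_def c_def fps_delta_subst_power)
  have S_add: "S (F + G) = S F + S G" for F G by (simp add: S_def fps_subst_power_add)
  have S_1: "S 1 = 1" by (simp add: S_def)
  have c: "c \<noteq> 0" "c \<in> \<int>\<^sub>p[[z]]"
    by (auto simp: c_def zero_less_card_finite)
  \<comment> \<open>With \<open>delta (S f) = p S (delta f)\<close>, equation \<open>E1\<close>
    takes the form of the recursion with two terms.\<close>
  have f: "f \<in> \<int>\<^sub>p[[z]]"
  proof (rule padic_integral_fps_frobenius_recursion)
    show "fps_const 1 * f = (\<Sum>j<2. (if j = 0 then B1 else B2 * c) *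
        fps_subst_power CARD('p) ((fps_delta ^^ j) f))"
      using E1 by (simp add: numeral_2_eq_2 delta_S S_def[symmetric] mult.assoc)
  qed (use B c(2) f0 in auto)
  define C where "C = B2 * S f * inverse f"
  have C: "C \<in> \<int>\<^sub>p[[z]]"
    unfolding C_def S_def using B f f0
    by (intro padic_integral_fps_mult padic_integral_fps_subst_power padic_integral_fps_inverse)
  have Cf: "C * f = B2 * S f"
    using inverse_mult_eq_1[of f] f0 by (simp add: C_def mult.assoc)
  define U where "U = 1 + fps_delta R"
  have SU: "S U = 1 + S (fps_delta R)" by (simp add: U_def S_add S_1)
  have "(S R - c * R) * f = - (c * (C * S U)) * f"
  proof -
    have "S R * f + c * (B2 * S f) * S U =
        S R * (B1 * S f + B2 * fps_delta (S f)) + c * (B2 * S f) * S U"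
      by (simp only: E1)
    also have "\<dots> = B1 * S (R * f) + B2 * (fps_delta (S (R * f)) + c * S f)"
      by (simp add: S_mult fps_delta_mult delta_S[of R] SU algebra_simps)
    also have "\<dots> = c * (R * f)" by (rule E2)
    finally show ?thesis by (simp add: Cf[symmetric] algebra_simps)
  qed
  moreover have "f \<noteq> 0" using f0 by auto
  ultimately have "S R - c * R = - (c * (C * S U))"
    using mult_right_cancel by blast
  then have diff: "S R - c * R = c * (- (C * S U))" by simp
  \<comment> \<open>Differentiation gives \<open>S R\<close> a factor p as well, so p cancels and an
    equation for \<open>U\<close> alone remains.\<close>
  then have "fps_delta (S R - c * R) = fps_delta (c * (- (C * S U)))" by simp
  then have "c * (S (fps_delta R) - fps_delta R + fps_delta (C * S U)) = 0"
    by (simp add: fps_delta_diff fps_delta_mult fps_delta_uminus delta_S algebra_simps c_def)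
  then have "S (fps_delta R) - fps_delta R + fps_delta (C * S U) = 0" using c(1) by simp
  then have "fps_delta (C * S U) = fps_delta R - S (fps_delta R)"
    by (simp add: add_eq_0_iff)
  moreover have "U - S U = fps_delta R - S (fps_delta R)"
    unfolding SU by (simp add: U_def)
  ultimately have "U = S U + fps_delta (C * S U)"
    by (metis add.commute diff_add_cancel)
  then have U_rec: "U = (1 + fps_delta C) * S U + C * c * S (fps_delta U)"
    by (simp add: fps_delta_mult delta_S algebra_simps)
  have "U \<in> \<int>\<^sub>p[[z]]"
  proof (rule padic_integral_fps_frobenius_recursion)
    show "fps_const 1 * U = (\<Sum>j<2. (if j = 0 then 1 + fps_delta C else C * c) *
        fps_subst_power CARD('p) ((fps_delta ^^ j) U))"
      using U_rec by (simp add: numeral_2_eq_2 S_def[symmetric])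
  qed (use C c(2) in \<open>auto simp: U_def\<close>)
  then have "- (C * S U) \<in> \<int>\<^sub>p[[z]]"
    using C by (auto simp: S_def)
  then show ?thesis
    using diff unfolding dieudonne_dwork_exp[OF R0] S_def c_def by blast
qed

text \<open>The elimination is reversed: the series \<open>G\<close> from
  \<open>dieudonne_dwork_exp\<close> forces \<open>B2 = - G f / (S f S U)\<close>, and
  \<open>E1\<close> then determines \<open>B1\<close>.\<close>

lemma frobenius_operator_of_canonical_coordinate_integral:
  fixes f R :: "'p::prime_card padic fps"
  defines "S \<equiv> fps_subst_power CARD('p)" and "c \<equiv> fps_const (of_nat CARD('p))"
  assumes f0: "fps_nth f 0 = 1" and R0: "fps_nth R 0 = 0"
    and f: "f \<in> \<int>\<^sub>p[[z]]" and E: "fps_exp 1 oo R \<in> \<int>\<^sub>p[[z]]"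
  obtains B1 B2 where "B1 \<in> \<int>\<^sub>p[[z]]" "B2 \<in> \<int>\<^sub>p[[z]]" "fps_nth B1 0 = 1" "fps_nth B2 0 = 0"
    "B1 * S f + B2 * fps_delta (S f) = f"
    "B1 * S (R * f) + B2 * (fps_delta (S (R * f)) + c * S f) = c * (R * f)"
proof -
  have S_mult: "S (F * G) = S F * S G" for F G by (simp add: S_def fps_subst_power_mult)
  have delta_S: "fps_delta (S F) = c * S (fps_delta F)" for F
    by (simp add: S_def c_def fps_delta_subst_power)
  have S_add: "S (F + G) = S F + S G" for F G by (simp add: S_def fps_subst_power_add)
  have S_1: "S 1 = 1" by (simp add: S_def)
  have S_0: "fps_nth (S F) 0 = fps_nth F 0" for F by (simp add: S_def)
  have S_int: "S F \<in> \<int>\<^sub>p[[z]]" if "F \<in> \<int>\<^sub>p[[z]]" for F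
    using that by (auto simp: S_def)
  obtain G where G: "G \<in> \<int>\<^sub>p[[z]]" "S R - c * R = c * G"
    using E unfolding dieudonne_dwork_exp[OF R0] S_def c_def by blast
  have G0: "fps_nth G 0 = 0"
    using arg_cong[OF G(2), of "\<lambda>F. fps_nth F 0"] by (simp add: S_0 R0 c_def zero_less_card_finite)
  define X where "X = fps_exp 1 oo R"
  have X: "X \<in> \<int>\<^sub>p[[z]]" "fps_nth X 0 = 1" "fps_delta X = X * fps_delta R"
    using E fps_delta_exp_compose[OF R0] by (simp_all add: X_def)
  \<comment> \<open>As the logarithmic derivative of an integral series with constant term 1,
    \<open>delta R\<close> is integral.\<close>
  have "fps_delta R = fps_delta X * inverse X"
    using inverse_mult_eq_1'[of X] X(2,3) by (simp add: mult_ac)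
  then have "fps_delta R \<in> \<int>\<^sub>p[[z]]"
    using X(1,2) padic_integral_fps_inverse by auto
  moreover define U where "U = 1 + fps_delta R"
  ultimately have U: "U \<in> \<int>\<^sub>p[[z]]" "fps_nth U 0 = 1" by auto
  have SU: "S U = 1 + S (fps_delta R)" by (simp add: U_def S_add S_1)
  define iU where "iU = inverse (S U)"
  define iF where "iF = inverse (S f)"
  have iU: "S U * iU = 1" "iU \<in> \<int>\<^sub>p[[z]]"
    unfolding iU_def using U(2)
    by (intro inverse_mult_eq_1' padic_integral_fps_inverse S_int U(1); simp add: S_0)+
  have iF: "S f * iF = 1" "iF \<in> \<int>\<^sub>p[[z]]"
    unfolding iF_def using f0
    by (intro inverse_mult_eq_1' padic_integral_fps_inverse S_int f; simp add: S_0)+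
  have iF0: "fps_nth iF 0 = 1" by (simp add: iF_def S_0 f0)
  define B2 where "B2 = - G * iU * f * iF"
  define B1 where "B1 = (f - B2 * fps_delta (S f)) * iF"
  have B2: "B2 \<in> \<int>\<^sub>p[[z]]" "fps_nth B2 0 = 0"
    using G(1) G0 iU iF f by (auto simp: B2_def)
  have B1: "B1 \<in> \<int>\<^sub>p[[z]]"
    unfolding B1_def
    by (intro padic_integral_fps_mult padic_integral_fps_diff padic_integral_fps_delta S_int f B2(1) iF(2))
  have B1_0: "fps_nth B1 0 = 1" by (simp add: B1_def f0 iF0)
  have "B1 * S f = (f - B2 * fps_delta (S f)) * (S f * iF)"
    by (simp only: B1_def mult_ac)
  then have E1: "B1 * S f + B2 * fps_delta (S f) = f" by (simp add: iF(1))
  have "B2 * S f * S U = - G * f * (S U * iU) * (S f * iF)"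
    by (simp only: B2_def mult_ac)
  then have B2_SU: "B2 * S f * S U = - G * f" by (simp add: iF(1) iU(1))
  have "B1 * S (R * f) + B2 * (fps_delta (S (R * f)) + c * S f) =
      S R * (B1 * S f + B2 * fps_delta (S f)) + c * (B2 * S f * S U)"
    by (simp add: S_mult fps_delta_mult delta_S[of R] SU algebra_simps)
  also have "\<dots> = (S R - c * G) * f"
    unfolding E1 B2_SU by (simp add: algebra_simps)
  also have "S R - c * G = c * R"
    using G(2) by (simp add: algebra_simps)
  finally have E2: "B1 * S (R * f) + B2 * (fps_delta (S (R * f)) + c * S f) = c * (R * f)"
    by (simp only: mult.assoc)
  show ?thesis by (rule that) fact+
qed

section \<open>Frobenius structures and integrality of the holomorphic solution\<close>

text \<open>Since the \<open>a j\<close> have no constant term, the coefficient at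
  \<open>z ^ k\<close> expresses \<open>k ^ n\<close> times the k-th coefficient of \<open>F\<close>
  through earlier ones.\<close>

lemma MUM_power_series_solution_eq_0:
  fixes a :: "nat \<Rightarrow> 'a::field_char_0 fps"
  assumes a0: "\<And>j. j < n \<Longrightarrow> fps_nth (a j) 0 = 0"
    and F: "(fps_delta ^^ n) F + (\<Sum>j<n. a j * (fps_delta ^^ j) F) = 0" "fps_nth F 0 = 0"
  shows "F = 0"
proof -
  have "fps_nth F k = 0" for k
  proof (induction k rule: less_induct)
    case (less k)
    have "fps_nth (a j) i * fps_nth ((fps_delta ^^ j) F) (k - i) = 0" if "j < n" "i \<le> k" for i j
      using that a0 less by (cases "i = 0") (auto simp: fps_delta_power_nth)
    then have "fps_nth (\<Sum>j<n. a j * (fps_delta ^^ j) F) k = 0"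
      unfolding fps_sum_nth fps_mult_nth by (intro sum.neutral ballI) auto
    then have "of_nat k ^ n * fps_nth F k = 0"
      using arg_cong[OF F(1), of "\<lambda>G. fps_nth G k"] by (simp add: fps_delta_power_nth)
    then show ?case using F(2) by (cases "k = 0") auto
  qed
  then show ?thesis by (simp add: fps_eq_iff)
qed

lemma fps_delta_power_lin:
  "(fps_delta ^^ j) (F - fps_const c * G) = (fps_delta ^^ j) F - fps_const c * (fps_delta ^^ j) G"
  by (auto simp: fps_eq_iff fps_delta_power_nth algebra_simps)

lemma fps_delta_sum: "fps_delta (sum F A) = (\<Sum>i\<in>A. fps_delta (F i))"
  by (induction A rule: infinite_finite_induct) (simp_all add: fps_delta_add)

text \<open>If \<open>Y\<close> is the column of derivatives of the solution \<open>F\<close>, then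
  \<open>\<delta> (\<Phi> Y(z ^ p)) = A \<Phi> Y(z ^ p)\<close>, so that the first entry of \<open>\<Phi> Y(z ^ p)\<close> is a power series
  solution, hence a multiple of \<open>F\<close>.\<close>

lemma frobenius_structure_recursion:
  fixes F :: "'a::field_char_0 fps" and \<Phi> :: "'a fps mat"
  assumes n: "n > 0" and p: "p > 0"
    and a0: "\<And>j. j < n \<Longrightarrow> fps_nth (coeff P j) 0 = 0"
    and F: "(fps_delta ^^ n) F + (\<Sum>j<n. coeff P j * (fps_delta ^^ j) F) = 0" "fps_nth F 0 = 1"
    and \<Phi>: "\<Phi> \<in> carrier_mat n n"
      "map_mat fps_delta \<Phi> = companion_matrix n P * \<Phi> -
        of_nat p \<cdot>\<^sub>m (\<Phi> * map_mat (fps_subst_power p) (companion_matrix n P))"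
  shows "fps_const (fps_nth (\<Phi> $$ (0, 0)) 0) * F =
    (\<Sum>j<n. \<Phi> $$ (0, j) * fps_subst_power p ((fps_delta ^^ j) F))"
proof -
  define A where "A = companion_matrix n P"
  define S where "S = (fps_subst_power p :: 'a fps \<Rightarrow> 'a fps)"
  define D where "D j = (fps_delta ^^ j) F" for j
  define w where "w i = (\<Sum>j<n. \<Phi> $$ (i, j) * S (D j))" for i
  have A: "A \<in> carrier_mat n n" by (simp add: A_def companion_matrix_def)
  have S_sum: "S (sum G I) = (\<Sum>i\<in>I. S (G i))" for G :: "nat \<Rightarrow> 'a fps" and I
    by (induction I rule: infinite_finite_induct)
      (simp_all add: S_def fps_subst_power_0[OF p] fps_subst_power_add[OF p])
  \<comment> \<open>Multiplication by \<open>A\<close> shifts entries by one; only the last row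
    involves the operator.\<close>
  have companion: "(\<Sum>j<n. A $$ (i, j) * x j) =
      (if i = n - 1 then - (\<Sum>j<n. coeff P j * x j) else x (Suc i))"
    if "i < n" for i and x :: "nat \<Rightarrow> 'a fps"
  proof (cases "i = n - 1")
    case True
    then show ?thesis using that by (simp add: A_def companion_matrix_def sum_negf)
  next
    case False
    then have "(\<Sum>j<n. A $$ (i, j) * x j) = (\<Sum>j<n. if j = Suc i then x j else 0)"
      using that by (intro sum.cong) (auto simp: A_def companion_matrix_def)
    then show ?thesis using that False by simp
  qed
  have "D n = - (\<Sum>j<n. coeff P j * D j)"
    using F(1) by (simp add: D_def eq_neg_iff_add_eq_0)
  then have D: "(\<Sum>j<n. A $$ (k, j) * D j) = D (Suc k)" if "k < n" for k
    using companion[OF that, of D] n by (cases "k = n - 1") auto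
  have \<Phi>_entry: "fps_delta (\<Phi> $$ (i, j)) = (\<Sum>k<n. A $$ (i, k) * \<Phi> $$ (k, j)) -
      of_nat p * (\<Sum>k<n. \<Phi> $$ (i, k) * S (A $$ (k, j)))" if "i < n" "j < n" for i j
    using arg_cong[OF \<Phi>(2), of "\<lambda>M. M $$ (i, j)"] that \<Phi>(1) A
    by (simp add: A_def[symmetric] S_def scalar_prod_def atLeast0LessThan)
  \<comment> \<open>The term of the Frobenius equation containing \<open>A(z ^ p)\<close> cancels
    against the factor p that \<open>delta\<close> produces on \<open>S (D j)\<close>.\<close>
  have delta_w: "fps_delta (w i) = (\<Sum>k<n. A $$ (i, k) * w k)" if i: "i < n" for i
  proof -
    have "(\<Sum>j<n. (\<Sum>k<n. \<Phi> $$ (i, k) * S (A $$ (k, j))) * S (D j)) =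
        (\<Sum>k<n. \<Phi> $$ (i, k) * S (\<Sum>j<n. A $$ (k, j) * D j))"
      unfolding S_sum sum_distrib_left sum_distrib_right
      by (subst sum.swap) (simp add: S_def fps_subst_power_mult[OF p] mult.assoc)
    also have "\<dots> = (\<Sum>k<n. \<Phi> $$ (i, k) * S (D (Suc k)))"
      by (intro sum.cong) (simp_all add: D)
    finally have 1: "(\<Sum>j<n. (\<Sum>k<n. \<Phi> $$ (i, k) * S (A $$ (k, j))) * S (D j)) =
        (\<Sum>k<n. \<Phi> $$ (i, k) * S (D (Suc k)))" .
    have 2: "(\<Sum>j<n. (\<Sum>k<n. A $$ (i, k) * \<Phi> $$ (k, j)) * S (D j)) = (\<Sum>k<n. A $$ (i, k) * w k)"
      unfolding w_def sum_distrib_left sum_distrib_right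
      by (subst sum.swap) (simp add: mult.assoc)
    have "fps_delta (w i) = (\<Sum>j<n. fps_delta (\<Phi> $$ (i, j)) * S (D j)) +
        of_nat p * (\<Sum>j<n. \<Phi> $$ (i, j) * S (D (Suc j)))"
      unfolding w_def fps_delta_sum fps_delta_mult sum.distrib sum_distrib_left
      by (simp add: S_def fps_delta_subst_power[OF p] D_def fps_of_nat mult_ac)
    also have "(\<Sum>j<n. fps_delta (\<Phi> $$ (i, j)) * S (D j)) = (\<Sum>k<n. A $$ (i, k) * w k) -
        of_nat p * (\<Sum>j<n. \<Phi> $$ (i, j) * S (D (Suc j)))"
      unfolding 1[symmetric] 2[symmetric] sum_distrib_left[of "of_nat p"] sum_subtractf[symmetric]
      by (intro sum.cong) (simp_all add: \<Phi>_entry i left_diff_distrib mult.assoc)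
    finally show ?thesis by simp
  qed
  have w: "w i = (fps_delta ^^ i) (w 0)" if "i < n" for i
    using that
  proof (induction i)
    case (Suc i)
    then have "fps_delta (w i) = w (Suc i)"
      using delta_w[of i] companion[of i w] by auto
    then show ?case using Suc by simp
  qed simp
  define c where "c = fps_nth (\<Phi> $$ (0, 0)) 0"
  \<comment> \<open>Positive powers of \<open>delta\<close> kill constant terms, so only
    \<open>j = 0\<close> contributes.\<close>
  have w0: "fps_nth (w 0) 0 = c"
  proof -
    have "fps_nth (w 0) 0 = (\<Sum>j<n. if j = 0 then c else 0)"
      unfolding w_def fps_sum_nth
      by (intro sum.cong) (auto simp: S_def D_def fps_delta_power_nth F(2) c_def
          fps_subst_power_nth_0[OF p])
    then show ?thesis using n by simp
  qed
  have ode: "(fps_delta ^^ n) (w 0) + (\<Sum>j<n. coeff P j * (fps_delta ^^ j) (w 0)) = 0"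
  proof -
    have "(fps_delta ^^ n) (w 0) = fps_delta (w (n - 1))"
      using w[of "n - 1"] n by (cases n) simp_all
    also have "\<dots> = - (\<Sum>j<n. coeff P j * w j)"
      using delta_w[of "n - 1"] companion[of "n - 1" w] n by simp
    also have "(\<Sum>j<n. coeff P j * w j) = (\<Sum>j<n. coeff P j * (fps_delta ^^ j) (w 0))"
      by (intro sum.cong) (simp_all flip: w)
    finally show ?thesis by simp
  qed
  \<comment> \<open>A solution without constant term vanishes, which makes \<open>w 0\<close> a
    multiple of \<open>F\<close>.\<close>
  have "w 0 - fps_const c * F = 0"
  proof (rule MUM_power_series_solution_eq_0[where a = "coeff P" and n = n])
    have "(\<Sum>j<n. coeff P j * (fps_delta ^^ j) (w 0 - fps_const c * F)) =
        (\<Sum>j<n. coeff P j * (fps_delta ^^ j) (w 0)) -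
        fps_const c * (\<Sum>j<n. coeff P j * (fps_delta ^^ j) F)"
      by (simp only: fps_delta_power_lin right_diff_distrib sum_subtractf sum_distrib_left
          mult.left_commute)
    moreover have "fps_const c * ((fps_delta ^^ n) F + (\<Sum>j<n. coeff P j * (fps_delta ^^ j) F)) = 0"
      by (simp only: F(1) mult_zero_right)
    ultimately show "(fps_delta ^^ n) (w 0 - fps_const c * F) +
        (\<Sum>j<n. coeff P j * (fps_delta ^^ j) (w 0 - fps_const c * F)) = 0"
      using ode by (simp only: fps_delta_power_lin distrib_left add_diff_add[symmetric] diff_self)
  qed (simp_all add: w0 F(2) a0)
  then show ?thesis by (simp add: w_def S_def D_def c_def)
qed

section \<open>Extension of scalars from \<open>\<rat>\<close>\<close>

lemma fps_of_rat_nth [simp]: "fps_nth (fps_of_rat F) k = of_rat (fps_nth F k)"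
  by (simp add: fps_of_rat_def)

lemma fps_of_rat_0 [simp]: "fps_of_rat 0 = 0"
  and fps_of_rat_1 [simp]: "fps_of_rat 1 = 1"
  and fps_of_rat_X [simp]: "fps_of_rat fps_X = fps_X"
  and fps_of_rat_add: "fps_of_rat (F + G) = fps_of_rat F + fps_of_rat G"
  and fps_of_rat_mult: "fps_of_rat (F * G) = fps_of_rat F * fps_of_rat G"
  and fps_of_rat_delta: "fps_of_rat (fps_delta F) = fps_delta (fps_of_rat F)"
  by (auto simp: fps_eq_iff fps_X_def of_rat_add of_rat_mult fps_mult_nth of_rat_sum)

lemma fps_of_rat_sum: "fps_of_rat (sum F A) = (\<Sum>i\<in>A. fps_of_rat (F i))"
  by (induction A rule: infinite_finite_induct) (simp_all add: fps_of_rat_add)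

lemma fps_of_rat_power: "fps_of_rat (F ^ n) = fps_of_rat F ^ n"
  by (induction n) (simp_all add: fps_of_rat_mult)

lemma fps_of_rat_delta_power: "fps_of_rat ((fps_delta ^^ j) F) = (fps_delta ^^ j) (fps_of_rat F)"
  by (induction j) (simp_all add: fps_of_rat_delta)

lemma fps_of_rat_exp_compose:
  "fps_of_rat (fps_exp 1 oo F) = (fps_exp 1 oo fps_of_rat F :: 'a::field_char_0 fps)"
proof (rule fps_ext)
  fix k
  have "(of_rat (fps_nth (F ^ i) k) :: 'a) = fps_nth (fps_of_rat F ^ i) k" for i
    by (simp flip: fps_of_rat_power)
  moreover have "(of_rat (fact i) :: 'a) = fact i" for i
    by (metis of_nat_fact of_rat_of_nat_eq)
  ultimately show "fps_nth (fps_of_rat (fps_exp 1 oo F)) k =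
      fps_nth (fps_exp 1 oo fps_of_rat F :: 'a fps) k"
    by (simp add: fps_compose_nth of_rat_sum of_rat_mult of_rat_divide)
qed

text \<open>After extension of scalars, the first row of \<open>\<Phi>\<close> supplies the
  coefficients of the integral recursion; norm 1 allows division by its leading constant.\<close>

lemma padic_integral_solution_of_frobenius_structure:
  fixes \<Phi> :: "'p::prime_card padic fps mat"
  assumes n: "n > 0" and MUM: "MUM_diffop n L"
    and f: "fps_nth f 0 = 1" "diffop_apply L [:f:] = 0"
    and \<Phi>: "frobenius_structure n L \<Phi>" "padic_norm (fps_nth (\<Phi> $$ (0, 0)) 0) = 1"
  shows "(fps_of_rat f :: 'p padic fps) \<in> \<int>\<^sub>p[[z]]"
proof -
  define P where "P = (diffop_of_rat L :: 'p padic diffop)"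
  define F where "F = (fps_of_rat f :: 'p padic fps)"
  have P: "coeff P j = fps_of_rat (coeff L j)" for j
    by (simp add: P_def diffop_of_rat_def coeff_map_poly)
  have \<Phi>': "\<Phi> \<in> carrier_mat n n" "elements_mat \<Phi> \<subseteq> \<int>\<^sub>p[[z]]"
    "map_mat fps_delta \<Phi> = companion_matrix n P * \<Phi> -
      of_nat CARD('p) \<cdot>\<^sub>m (\<Phi> * map_mat (fps_subst_power CARD('p)) (companion_matrix n P))"
    using \<Phi>(1) by (simp_all add: frobenius_structure_def Let_def P_def)
  have entry: "\<Phi> $$ (0, j) \<in> \<int>\<^sub>p[[z]]" if "j < n" for j
    using \<Phi>'(2) elements_matI[OF \<Phi>'(1) n that] by blast
  have F0: "fps_nth F 0 = 1" by (simp add: F_def f(1))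
  have "(\<Sum>j\<le>n. coeff L j * (fps_delta ^^ j) f) = 0"
    using f(2) MUM by (simp add: diffop_apply_const MUM_diffop_def)
  then have "fps_of_rat (\<Sum>j\<le>n. coeff L j * (fps_delta ^^ j) f) = (0 :: 'p padic fps)"
    by simp
  then have "(\<Sum>j\<le>n. coeff P j * (fps_delta ^^ j) F) = 0"
    by (simp add: fps_of_rat_sum fps_of_rat_mult fps_of_rat_delta_power P F_def)
  moreover have "coeff P n = 1" using MUM by (simp add: P MUM_diffop_def)
  ultimately have ode: "(fps_delta ^^ n) F + (\<Sum>j<n. coeff P j * (fps_delta ^^ j) F) = 0"
    by (simp add: lessThan_Suc_atMost[symmetric] add.commute)
  have "fps_nth (coeff P j) 0 = 0" if "j < n" for j
    using MUM that by (simp add: P MUM_diffop_def)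
  note rec = frobenius_structure_recursion[OF n card_pos[where 'p = 'p] this ode F0 \<Phi>'(1,3)]
  have "fps_nth (\<Phi> $$ (0, 0)) 0 \<in> \<int>\<^sub>p"
    using entry n by (simp add: padic_integral_fpsD)
  then have inv: "inverse (fps_nth (\<Phi> $$ (0, 0)) 0) \<in> \<int>\<^sub>p"
    by (rule padic_norm_eq_1_imp_inverse[OF _ \<Phi>(2)])
  have "fps_nth (\<Phi> $$ (0, 0)) 0 \<noteq> 0" using \<Phi>(2) by (auto simp: padic_norm_def)
  then have "F \<in> \<int>\<^sub>p[[z]]"
    using padic_integral_fps_frobenius_recursion[OF entry inv _ _ rec] F0 by simp
  then show ?thesis by (simp add: F_def)
qed

lemma fps_of_rat_canonical_coordinate_integral_iff:
  fixes f g :: "rat fps"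
  shows "(\<exists>F\<in>\<int>\<^sub>p[[z]]. (fps_of_rat (canonical_coordinate f g) :: 'p::prime_card padic fps) = fps_X * F) \<longleftrightarrow>
    fps_exp 1 oo fps_of_rat (g / f) \<in> (\<int>\<^sub>p[[z]] :: 'p padic fps set)"
  by (auto simp: canonical_coordinate_def fps_of_rat_mult fps_of_rat_exp_compose)

theorem mainTheorem5:
  fixes p n :: nat
    and L :: "rat diffop"
    and f g :: "rat fps"
    and \<Phi> :: "'p::prime_card padic fps mat"
  assumes "prime p" and "p = CARD('p)"
    and "n \<ge> 2"
    and "MUM_diffop n L"
    and "frobenius_solutions L f g"
    and "(diffop_of_rat L :: 'p padic diffop) \<in> \<int>\<^sub>p[[z]][\<delta>]"
    and "frobenius_structure n L \<Phi>"
    and "padic_norm (fps_nth (\<Phi> $$ (0, 0)) 0) = 1"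
  shows "(\<exists>F \<in> \<int>\<^sub>p[[z]]. (fps_of_rat (canonical_coordinate f g) :: 'p padic fps) = fps_X * F) \<longleftrightarrow>
    (\<exists>B1 B2 :: 'p padic fps. [:B1, B2:] \<in> \<int>\<^sub>p[[z]][\<delta>] \<and> fps_nth B1 0 = 1 \<and> fps_nth B2 0 = 0 \<and>
      (let L2 = second_order_diffop (fps_of_rat f) (fps_of_rat g) in
        \<forall>y. is_log_solution L2 y \<longrightarrow>
          is_log_solution L2 (diffop_apply [:B1, B2:] (log_subst_power p y))))"
proof -
  define R where "R = (fps_of_rat (g / f) :: 'p padic fps)"
  define F where "F = (fps_of_rat f :: 'p padic fps)"
  note p = \<open>p = CARD('p)\<close>
  have f: "fps_nth f 0 = 1" "fps_nth g 0 = 0" "diffop_apply L [:f:] = 0"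
    using assms(5) by (simp_all add: frobenius_solutions_def)
  \<comment> \<open>The division is exact because \<open>f\<close> has constant term 1.\<close>
  have gf: "g / f * f = g" by (rule fps_divide_times_unit) (simp add: f)
  have RF: "fps_of_rat g = R * F"
    unfolding R_def F_def fps_of_rat_mult[symmetric] gf ..
  have F0: "fps_nth F 0 = 1" by (simp add: F_def f)
  have g0: "fps_nth (R * F) 0 = 0" unfolding RF[symmetric] by (simp add: f)
  with F0 have R0: "fps_nth R 0 = 0" by simp
  \<comment> \<open>The Frobenius structure enters here: it makes \<open>F\<close> integral before
    any \<open>B1\<close> and \<open>B2\<close> are available.\<close>
  have F: "F \<in> \<int>\<^sub>p[[z]]"
    unfolding F_def
    by (rule padic_integral_solution_of_frobenius_structure) (use assms f in auto)
  have integral: "[:B1, B2:] \<in> \<int>\<^sub>p[[z]][\<delta>] \<longleftrightarrow> B1 \<in> \<int>\<^sub>p[[z]] \<and> B2 \<in> \<int>\<^sub>p[[z]]" for B1 B2 :: "'p padic fps"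
  proof
    assume "[:B1, B2:] \<in> \<int>\<^sub>p[[z]][\<delta>]"
    then have "coeff [:B1, B2:] 0 \<in> \<int>\<^sub>p[[z]]" "coeff [:B1, B2:] 1 \<in> \<int>\<^sub>p[[z]]"
      by (simp_all only: padic_integral_diffop_def mem_Collect_eq)
    then show "B1 \<in> \<int>\<^sub>p[[z]] \<and> B2 \<in> \<int>\<^sub>p[[z]]" by simp
  qed (auto simp: padic_integral_diffop_def coeff_pCons split: nat.splits)
  note frob = frobenius_operator_iff[OF F0 g0 card_pos[where 'p = 'p]]
  show ?thesis
    unfolding fps_of_rat_canonical_coordinate_integral_iff Let_def p RF R_def[symmetric] F_def[symmetric]
      integral
  proof
    assume "fps_exp 1 oo R \<in> \<int>\<^sub>p[[z]]"
    then show "\<exists>B1 B2. (B1 \<in> \<int>\<^sub>p[[z]] \<and> B2 \<in> \<int>\<^sub>p[[z]]) \<and> fps_nth B1 0 = 1 \<and> fps_nth B2 0 = 0 \<and>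
      (\<forall>y. is_log_solution (second_order_diffop F (R * F)) y \<longrightarrow>
        is_log_solution (second_order_diffop F (R * F))
          (diffop_apply [:B1, B2:] (log_subst_power CARD('p) y)))"
      by (rule frobenius_operator_of_canonical_coordinate_integral[OF F0 R0 F]) (use frob in blast)
  next
    assume "\<exists>B1 B2. (B1 \<in> \<int>\<^sub>p[[z]] \<and> B2 \<in> \<int>\<^sub>p[[z]]) \<and> fps_nth B1 0 = 1 \<and> fps_nth B2 0 = 0 \<and>
      (\<forall>y. is_log_solution (second_order_diffop F (R * F)) y \<longrightarrow>
        is_log_solution (second_order_diffop F (R * F))
          (diffop_apply [:B1, B2:] (log_subst_power CARD('p) y)))"
    then obtain B1 B2 where "B1 \<in> \<int>\<^sub>p[[z]]" "B2 \<in> \<int>\<^sub>p[[z]]"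
      "B1 * fps_subst_power CARD('p) F + B2 * fps_delta (fps_subst_power CARD('p) F) = F"
      "B1 * fps_subst_power CARD('p) (R * F) + B2 * (fps_delta (fps_subst_power CARD('p) (R * F)) +
        fps_const (of_nat CARD('p)) * fps_subst_power CARD('p) F) =
        fps_const (of_nat CARD('p)) * (R * F)"
      using frob by blast
    then show "fps_exp 1 oo R \<in> \<int>\<^sub>p[[z]]"
      by (rule canonical_coordinate_integral_of_frobenius_operator[OF F0 R0])
  qed
qed

end
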